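(* Let $m>0$, $|a|<m$, $S<0$, $R,\widetilde R\in\mathbb R$, $X=S(\widetilde r-\widetilde R)$, and let $s$ be an integer spin. Let $\psi$ be a smooth complex function on the Kerr exterior in outgoing coordinates $(u,r,\theta,\varphi)$, with support bounded in $r$ and vanishing at $r=r_+$ together with its derivatives, and let $\widetilde\psi=\mathfrak W[\psi]$ be its generalized Whiting transform. Then $$|\widetilde q|^2\widetilde{\mathfrak L}^{[s]}\widetilde\psi=\mathfrak W\big[|q|^2\mathfrak L^{[s]}\psi\big],$$ where $$|\widetilde q|^2\widetilde{\mathfrak L}^{[s]}\widetilde\psi=|\widetilde q|^2\square_{\widetilde{\mathbf g}}\widetilde\psi-\frac{2s}S(X+2)\partial_{\widetilde r}\widetilde\psi-2s\big((R-m)X+2R+ia\cos\widetilde\theta\big)\partial_{\widetilde v}\widetilde\psi+2is\frac{\cos\widetilde\theta}{\sin^2\widetilde\theta}\partial_{\widetilde\varphi}\widetilde\psi-\big(s+s^2\cot^2\widetilde\theta\big)\widetilde\psi .$$ Moreover, for $X\ne0$, setting $\widetilde\psi^{[s]}=(\widetilde r-\widetilde R)^{-s}\widetilde\psi$ and $$\mathfrak P^{[s]}_{\widetilde{\mathbf g}}:=|\widetilde q|^2\square_{\widetilde{\mathbf g}}-2ias\cos\widetilde\theta\,\partial_{\widetilde v}+\frac{2is\cos\widetilde\theta}{\sin^2\widetilde\theta}\partial_{\widetilde\varphi}-s^2\Big(1+\frac2X+\cot^2\widetilde\theta\Big),$$ one has $$\mathfrak P^{[s]}_{\widetilde{\mathbf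 g}}\widetilde\psi^{[s]}=(\widetilde r-\widetilde R)^{-s}\,\mathfrak W\big[|q|^2\mathfrak L^{[s]}\psi\big].$$
   Context: **Kerr in outgoing coordinates.** $\Delta=r^2-2mr+a^2=(r-r_+)(r-r_-)$, $r_\pm=m\pm\sqrt{m^2-a^2}$, $q=r+ia\cos\theta$. With Boyer–Lindquist $(t,r,\theta,\phi)$, $u=t-r_*$, $\varphi=\phi-\phi_*$, $r_*'=\frac{r^2+a^2}\Delta$, $\phi_*'=\frac a\Delta$. The scalar wave operator is $$|q|^2\square_{\mathbf g}\psi=\partial_r(\Delta\partial_r\psi)-\partial_u((r^2+a^2)\partial_r\psi)-\partial_r((r^2+a^2)\partial_u\psi)-2a\partial_r\partial_\varphi\psi+\mathcal O\psi,$$ $$\mathcal O\psi=\frac1{\sin\theta}\partial_\theta(\sin\theta\,\partial_\theta\psi)+\frac1{\sin^2\theta}\partial_\varphi^2\psi+2a\partial_u\partial_\varphi\psi+a^2\sin^2\theta\,\partial_u^2\psi .$$ The spin-$s$ Teukolsky operator $\mathfrak L^{[s]}$ in these coordinates is $$|q|^2\mathfrak L^{[s]}=|q|^2\square_{\mathbf g}+2s(r-m)\partial_r+2s(-2r-ia\cos\theta)\partial_u+2is\frac{\cos\theta}{\sin^2\theta}\partial_\varphi+(s-s^2\cot^2\theta).$$ **Transform.** $\mathfrak W[\psi](\widetilde v,\widetilde r,\widetilde\theta,\widetilde\varphi)=\int_{r_+}^\infty\psi\big(\widetilde v+X(r-R),r,\widetilde\theta,\widetilde\varphi\big)\,dr$.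 **Transformed wave operator.** $|\widetilde q|^2\square_{\widetilde{\mathbf g}}\widetilde\psi:=\partial_\alpha(\widetilde{\mathbf h}^{\alpha\beta}\partial_\beta\widetilde\psi)+\widetilde{\mathcal O}\widetilde\psi$, where $\widetilde{\mathbf h}$ is symmetric with non-vanishing components $\widetilde{\mathbf h}^{\widetilde r\widetilde r}=S^{-2}X(X+2)$, $\widetilde{\mathbf h}^{\widetilde v\widetilde r}=S^{-1}((R-m)X^2+2RX)$, $\widetilde{\mathbf h}^{\widetilde v\widetilde v}=\Delta(R)X^2+2(R^2+a^2)X$, $\widetilde{\mathbf h}^{\widetilde v\widetilde\varphi}=aX$, and $\widetilde{\mathcal O}$ is $\mathcal O$ with $(u,\theta,\varphi)$ replaced by $(\widetilde v,\widetilde\theta,\widetilde\varphi)$. The identities are understood away from the poles $\sin\theta=0$. *)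

theory Defs
  imports "HOL-Analysis.Analysis"
begin

text \<open>A point is a tuple of coordinates, either \<open>(u, r, \<theta>, \<phi>)\<close> (outgoing Kerr coordinates)
  or \<open>(v, r, \<theta>, \<phi>)\<close> (transformed coordinates). Azimuthal coordinates are real numbers; functions
  on the Kerr exterior are \<open>2 * pi\<close>-periodic in them.\<close>

type_synonym coords = "real \<times> real \<times> real \<times> real"
type_synonym cfun = "coords \<Rightarrow> complex"

subsection \<open>Smoothness\<close>

definition dir_deriv ::
    "'a::real_normed_vector set \<Rightarrow> 'a \<Rightarrow> ('a \<Rightarrow> 'b::real_normed_vector) \<Rightarrow> 'a \<Rightarrow> 'b" where
  "dir_deriv A v f = (\<lambda>x. frechet_derivative f (at x within A) v)"

definition iter_deriv ::
    "'a::real_normed_vector set \<Rightarrow> 'a list \<Rightarrow> ('a \<Rightarrow> 'b::real_normed_vector) \<Rightarrow> 'a \<Rightarrow> 'b" where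
  "iter_deriv A vs f = foldr (dir_deriv A) vs f"

text \<open>Smoothness up to the boundary points that belong to \<open>A\<close>, where derivatives are one-sided.
  Only meant for sets, such as a convex set with nonempty interior, on which Frechet derivatives
  within \<open>A\<close> are unique.\<close>

definition smooth_on :: "'a::real_normed_vector set \<Rightarrow> ('a \<Rightarrow> 'b::real_normed_vector) \<Rightarrow> bool" where
  "smooth_on A f \<longleftrightarrow> (\<forall>vs. iter_deriv A vs f differentiable_on A)"

subsection \<open>Coordinate partial derivatives\<close>

fun D\<^sub>t :: "cfun \<Rightarrow> cfun" where
  "D\<^sub>t f (t, r, \<theta>, \<phi>) = vector_derivative (\<lambda>x. f (x, r, \<theta>, \<phi>)) (at t)"

fun D\<^sub>r :: "cfun \<Rightarrow> cfun" where
  "D\<^sub>r f (t, r, \<theta>, \<phi>) = vector_derivative (\<lambda>x. f (t, x, \<theta>, \<phi>)) (at r)"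

fun D\<^sub>\<theta> :: "cfun \<Rightarrow> cfun" where
  "D\<^sub>\<theta> f (t, r, \<theta>, \<phi>) = vector_derivative (\<lambda>x. f (t, r, x, \<phi>)) (at \<theta>)"

fun D\<^sub>\<phi> :: "cfun \<Rightarrow> cfun" where
  "D\<^sub>\<phi> f (t, r, \<theta>, \<phi>) = vector_derivative (\<lambda>x. f (t, r, \<theta>, x)) (at \<phi>)"

definition pd :: "nat \<Rightarrow> cfun \<Rightarrow> cfun" where
  "pd \<alpha> = [D\<^sub>t, D\<^sub>r, D\<^sub>\<theta>, D\<^sub>\<phi>] ! \<alpha>"

subsection \<open>The Kerr exterior and the Teukolsky operator\<close>

definition Delta :: "real \<Rightarrow> real \<Rightarrow> real \<Rightarrow> real" where
  "Delta m a r = r\<^sup>2 - 2 * m * r + a\<^sup>2"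

definition r_plus :: "real \<Rightarrow> real \<Rightarrow> real" where
  "r_plus m a = m + sqrt (m\<^sup>2 - a\<^sup>2)"

text \<open>The horizon \<open>r = r_plus m a\<close> is included, so that vanishing there makes sense; the poles
  are excluded, so no regularity at the axis is imposed.\<close>

definition kerr_exterior :: "real \<Rightarrow> real \<Rightarrow> coords set" where
  "kerr_exterior m a = {(u, r, \<theta>, \<phi>). r_plus m a \<le> r \<and> 0 < \<theta> \<and> \<theta> < pi}"

text \<open>The operator \<open>\<O>\<close> does not involve the radial coordinate, so the same definition serves for
  both coordinate systems. The operators called \<open>wave_op\<close> and \<open>teukolsky\<close> below
  include the factor \<open>\<bar>q\<bar>\<^sup>2\<close>.\<close>

fun ang_op :: "real \<Rightarrow> cfun \<Rightarrow> cfun" where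
  "ang_op a \<psi> (t, r, \<theta>, \<phi>) =
     (1 / sin \<theta>) *\<^sub>R D\<^sub>\<theta> (\<lambda>(t, r, \<theta>, \<phi>). sin \<theta> *\<^sub>R D\<^sub>\<theta> \<psi> (t, r, \<theta>, \<phi>)) (t, r, \<theta>, \<phi>)
   + (1 / (sin \<theta>)\<^sup>2) *\<^sub>R D\<^sub>\<phi> (D\<^sub>\<phi> \<psi>) (t, r, \<theta>, \<phi>)
   + (2 * a) *\<^sub>R D\<^sub>t (D\<^sub>\<phi> \<psi>) (t, r, \<theta>, \<phi>)
   + (a\<^sup>2 * (sin \<theta>)\<^sup>2) *\<^sub>R D\<^sub>t (D\<^sub>t \<psi>) (t, r, \<theta>, \<phi>)"

fun wave_op :: "real \<Rightarrow> real \<Rightarrow> cfun \<Rightarrow> cfun" where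
  "wave_op m a \<psi> (u, r, \<theta>, \<phi>) =
     D\<^sub>r (\<lambda>(u, r, \<theta>, \<phi>). Delta m a r *\<^sub>R D\<^sub>r \<psi> (u, r, \<theta>, \<phi>)) (u, r, \<theta>, \<phi>)
   - D\<^sub>t (\<lambda>(u, r, \<theta>, \<phi>). (r\<^sup>2 + a\<^sup>2) *\<^sub>R D\<^sub>r \<psi> (u, r, \<theta>, \<phi>)) (u, r, \<theta>, \<phi>)
   - D\<^sub>r (\<lambda>(u, r, \<theta>, \<phi>). (r\<^sup>2 + a\<^sup>2) *\<^sub>R D\<^sub>t \<psi> (u, r, \<theta>, \<phi>)) (u, r, \<theta>, \<phi>)
   - (2 * a) *\<^sub>R D\<^sub>r (D\<^sub>\<phi> \<psi>) (u, r, \<theta>, \<phi>)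
   + ang_op a \<psi> (u, r, \<theta>, \<phi>)"

fun teukolsky :: "real \<Rightarrow> real \<Rightarrow> int \<Rightarrow> cfun \<Rightarrow> cfun" where
  "teukolsky m a s \<psi> (u, r, \<theta>, \<phi>) =
     wave_op m a \<psi> (u, r, \<theta>, \<phi>)
   + 2 * of_int s * of_real (r - m) * D\<^sub>r \<psi> (u, r, \<theta>, \<phi>)
   + 2 * of_int s * (- 2 * of_real r - \<i> * of_real (a * cos \<theta>)) * D\<^sub>t \<psi> (u, r, \<theta>, \<phi>)
   + 2 * \<i> * of_int s * of_real (cos \<theta> / (sin \<theta>)\<^sup>2) * D\<^sub>\<phi> \<psi> (u, r, \<theta>, \<phi>)
   + of_real (of_int s - (of_int s)\<^sup>2 * (cot \<theta>)\<^sup>2) * \<psi> (u, r, \<theta>, \<phi>)"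

subsection \<open>The generalized Whiting transform and the transformed operators\<close>

definition Xfun :: "real \<Rightarrow> real \<Rightarrow> real \<Rightarrow> real" where
  "Xfun S R' r = S * (r - R')"

fun whiting :: "real \<Rightarrow> real \<Rightarrow> real \<Rightarrow> real \<Rightarrow> real \<Rightarrow> cfun \<Rightarrow> cfun" where
  "whiting m a S R R' \<psi> (v, r', \<theta>, \<phi>) =
     integral {r_plus m a <..} (\<lambda>r. \<psi> (v + Xfun S R' r' * (r - R), r, \<theta>, \<phi>))"

text \<open>Coordinates are numbered \<open>v = 0\<close>, \<open>r = 1\<close>, \<open>\<theta> = 2\<close>, \<open>\<phi> = 3\<close>, as in \<open>pd\<close>. Comparing the sets
  of indices makes the components symmetric.\<close>

fun htilde :: "real \<Rightarrow> real \<Rightarrow> real \<Rightarrow> real \<Rightarrow> real \<Rightarrow> nat \<Rightarrow> nat \<Rightarrow> coords \<Rightarrow> real" where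
  "htilde m a S R R' \<alpha> \<beta> (v, r, \<theta>, \<phi>) =
    (let X = Xfun S R' r in
      if {\<alpha>, \<beta>} = {1} then X * (X + 2) / S\<^sup>2
      else if {\<alpha>, \<beta>} = {0, 1} then ((R - m) * X\<^sup>2 + 2 * R * X) / S
      else if {\<alpha>, \<beta>} = {0} then Delta m a R * X\<^sup>2 + 2 * (R\<^sup>2 + a\<^sup>2) * X
      else if {\<alpha>, \<beta>} = {0, 3} then a * X
      else 0)"

definition wave_op_tilde :: "real \<Rightarrow> real \<Rightarrow> real \<Rightarrow> real \<Rightarrow> real \<Rightarrow> cfun \<Rightarrow> cfun" where
  "wave_op_tilde m a S R R' \<psi> x =
     (\<Sum>\<alpha><4. \<Sum>\<beta><4. pd \<alpha> (\<lambda>y. htilde m a S R R' \<alpha> \<beta> y *\<^sub>R pd \<beta> \<psi> y) x) + ang_op a \<psi> x"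

fun teukolsky_tilde :: "real \<Rightarrow> real \<Rightarrow> real \<Rightarrow> real \<Rightarrow> real \<Rightarrow> int \<Rightarrow> cfun \<Rightarrow> cfun" where
  "teukolsky_tilde m a S R R' s \<psi> (v, r, \<theta>, \<phi>) =
    (let X = Xfun S R' r in
     wave_op_tilde m a S R R' \<psi> (v, r, \<theta>, \<phi>)
   - of_real (2 * of_int s / S * (X + 2)) * D\<^sub>r \<psi> (v, r, \<theta>, \<phi>)
   - 2 * of_int s * (of_real ((R - m) * X + 2 * R) + \<i> * of_real (a * cos \<theta>)) * D\<^sub>t \<psi> (v, r, \<theta>, \<phi>)
   + 2 * \<i> * of_int s * of_real (cos \<theta> / (sin \<theta>)\<^sup>2) * D\<^sub>\<phi> \<psi> (v, r, \<theta>, \<phi>)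
   - of_real (of_int s + (of_int s)\<^sup>2 * (cot \<theta>)\<^sup>2) * \<psi> (v, r, \<theta>, \<phi>))"

fun P_tilde :: "real \<Rightarrow> real \<Rightarrow> real \<Rightarrow> real \<Rightarrow> real \<Rightarrow> int \<Rightarrow> cfun \<Rightarrow> cfun" where
  "P_tilde m a S R R' s \<psi> (v, r, \<theta>, \<phi>) =
    (let X = Xfun S R' r in
     wave_op_tilde m a S R R' \<psi> (v, r, \<theta>, \<phi>)
   - 2 * \<i> * of_int s * of_real (a * cos \<theta>) * D\<^sub>t \<psi> (v, r, \<theta>, \<phi>)
   + 2 * \<i> * of_int s * of_real (cos \<theta> / (sin \<theta>)\<^sup>2) * D\<^sub>\<phi> \<psi> (v, r, \<theta>, \<phi>)
   - of_real ((of_int s)\<^sup>2 * (1 + 2 / X + (cot \<theta>)\<^sup>2)) * \<psi> (v, r, \<theta>, \<phi>))"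

fun rescale :: "real \<Rightarrow> int \<Rightarrow> cfun \<Rightarrow> cfun" where
  "rescale R' s \<psi> (v, r, \<theta>, \<phi>) = ((r - R') powi (- s)) *\<^sub>R \<psi> (v, r, \<theta>, \<phi>)"

end

(* Along the ray r |-> (v + X (r - R), r, theta, phi) the total r-derivative is X d_u + d_r. As the
   boundary terms vanish, integration by parts therefore trades d_r under the transform for -X d_u,
   plus derivatives of the weights. In the transformed variable, d_r' acts as multiplication by
   S (r - R) followed by d_u. Hence both sides become combinations of the moments (integrals against
   r^k) of d_u-, theta- and phi-derivatives of psi, and the first identity is an identity of
   polynomials in X. The second follows by conjugating with (r' - R')^(-s). *)
theory Submission
  imports Defs
begin

subsection \<open>Directional derivatives\<close>

text \<open>The components of \<open>htilde\<close> are Taylor coefficients at r = R. With -X d_u in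
  place of d_r, the radial part of the Kerr operator becomes, up to lower order, (Delta(r) X^2 + 2
  (r^2 + a^2) X) d_u^2 + 2 a X d_u d_\<phi>. Expanding the first coefficient in powers of r - R and
  reading S (r - R) d_u as d_r' yields the components rr, vr and vv; the last term yields v\<phi>.
  Likewise 2 s (r - m) d_r accounts for the new first-order terms, and the derivative of its weight
  leaves -2 s, which turns the constant s into -s. Two obstacles shape the proof. Iterated Frechet
  derivatives within a set that contains the horizon are not symmetric by definition, so jets keep
  both orders of each mixed derivative, and only u and \<phi> are ever exchanged. And the coordinate
  derivatives in the operators are two-sided, hence not controlled by the hypotheses at r = r_+:
  operators are evaluated for r > r_+ only, while integration by parts works with derivatives within
  the exterior, down to the horizon.\<close>

lemma mixed_partials_commute:
  fixes f :: "real \<Rightarrow> real \<Rightarrow> 'b::banach"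
  assumes fs: "\<And>s y. ((\<lambda>s. f s y) has_vector_derivative fs s y) (at s)"
    and fy: "\<And>s y. ((\<lambda>y. f s y) has_vector_derivative fy s y) (at y)"
    and fys: "\<And>s y. ((\<lambda>s. fy s y) has_vector_derivative fys s y) (at s)"
    and fsy: "\<And>s y. ((\<lambda>y. fs s y) has_vector_derivative fsy s y) (at y)"
    and cont: "continuous_on UNIV (\<lambda>(s, y). fys s y)"
  shows "fys s y = fsy s y"
proof -
  \<comment> \<open>The base point lies strictly below y, so that the derivative within
    \<open>{a..y+1}\<close> found below is two-sided at y.\<close>
  define a where "a = y - 1"
  have ftc: "(fy s has_integral f s z - f s a) {a..z}" if "a \<le> z" for s z
    by (rule fundamental_theorem_of_calculus[OF that])
      (blast intro: has_vector_derivative_at_within[OF fy])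
  \<comment> \<open>\<open>f s z - f s a\<close> is the integral of \<open>fy s\<close>;
    differentiating in s under the integral sign writes \<open>fs s z - fs s a\<close> as an
    integral of \<open>fys s\<close>. Its z-derivative at y is then \<open>fys s y\<close> by
    continuity, and \<open>fsy s y\<close> by assumption.\<close>
  have leibniz: "integral {a..z} (fys s) = fs s z - fs s a" if "a \<le> z" for z
  proof -
    have "((\<lambda>s. integral (cbox a z) (fy s)) has_vector_derivative integral (cbox a z) (fys s)) (at s within UNIV)"
    proof (rule leibniz_rule_vector_derivative)
      show "((\<lambda>s. fy s y) has_vector_derivative fys s y) (at s within UNIV)" for s y
        by (simp add: fys)
      show "fy s integrable_on cbox a z" for s
        using ftc[OF that] by (auto simp: integrable_on_def)
      show "continuous_on (UNIV \<times> cbox a z) (\<lambda>(s, y). fys s y)"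
        by (rule continuous_on_subset[OF cont]) auto
    qed auto
    moreover have "integral (cbox a z) (fy s) = f s z - f s a" for s
      using ftc[OF that] by (simp add: integral_unique)
    moreover have "((\<lambda>s. f s z - f s a) has_vector_derivative fs s z - fs s a) (at s)"
      by (intro has_vector_derivative_diff fs)
    ultimately show ?thesis
      by (simp add: vector_derivative_unique_at)
  qed
  have "((\<lambda>z. integral {a..z} (fys s)) has_vector_derivative fys s y) (at y within {a..y+1})"
  proof (rule integral_has_vector_derivative)
    have "continuous_on UNIV ((\<lambda>(s, y). fys s y) \<circ> Pair s)"
      by (intro continuous_on_compose continuous_intros continuous_on_subset[OF cont]) auto
    then show "continuous_on {a..y+1} (fys s)"
      by (auto simp: o_def intro: continuous_on_subset)
  qed (auto simp: a_def)
  then have "((\<lambda>z. integral {a..z} (fys s)) has_vector_derivative fys s y) (at y)"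
    by (simp add: a_def at_within_Icc_at)
  then have "((\<lambda>z. fs s z - fs s a) has_vector_derivative fys s y) (at y)"
    by (rule has_vector_derivative_transform_within_open[where S = "{a<..}"])
      (use leibniz in \<open>auto simp: a_def\<close>)
  moreover have "((\<lambda>z. fs s z - fs s a) has_vector_derivative fsy s y - 0) (at y)"
    by (intro has_vector_derivative_diff fsy) auto
  ultimately have "fys s y = fsy s y - 0"
    by (rule vector_derivative_unique_at)
  then show ?thesis
    by simp
qed

text \<open>Only restrictions to lines matter, since the coordinate operators are one-variable
  derivatives. The derivative is carried along as a function so that it can be differentiated
  again.\<close>

definition has_dd ::
    "'a::real_normed_vector set \<Rightarrow> 'a \<Rightarrow> ('a \<Rightarrow> 'b::real_normed_vector) \<Rightarrow> ('a \<Rightarrow> 'b) \<Rightarrow> bool" where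
  "has_dd U e f f' \<longleftrightarrow> (\<forall>x\<in>U. ((\<lambda>h. f (x + h *\<^sub>R e)) has_vector_derivative f' x) (at 0))"

lemma open_line_vimage:
  fixes x e :: "'a::real_normed_vector"
  assumes "open U"
  shows "open ((\<lambda>h::real. x + h *\<^sub>R e) -` U)"
  by (rule open_vimage[OF assms]) (auto intro!: continuous_intros)

lemma has_dd_cong:
  assumes "has_dd U e f f'" "open U" "\<And>x. x \<in> U \<Longrightarrow> f x = g x" "\<And>x. x \<in> U \<Longrightarrow> f' x = g' x"
  shows "has_dd U e g g'"
  unfolding has_dd_def
proof
  fix x assume x: "x \<in> U"
  have "((\<lambda>h. f (x + h *\<^sub>R e)) has_vector_derivative g' x) (at 0)"
    using assms x by (simp add: has_dd_def)
  then show "((\<lambda>h. g (x + h *\<^sub>R e)) has_vector_derivative g' x) (at 0)"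
    by (rule has_vector_derivative_transform_within_open[OF _ open_line_vimage[OF \<open>open U\<close>]])
      (use assms x in auto)
qed

lemma has_dd_subset: "has_dd U e f f' \<Longrightarrow> V \<subseteq> U \<Longrightarrow> has_dd V e f f'"
  by (auto simp: has_dd_def)

lemma has_dd_unique: "has_dd U e f f' \<Longrightarrow> has_dd U e f g' \<Longrightarrow> x \<in> U \<Longrightarrow> f' x = g' x"
  unfolding has_dd_def using vector_derivative_unique_at by metis

lemma has_dd_const: "has_dd U e (\<lambda>x. k) (\<lambda>x. 0)"
  by (auto simp: has_dd_def)

lemma has_dd_add:
  "has_dd U e f f' \<Longrightarrow> has_dd U e g g' \<Longrightarrow> has_dd U e (\<lambda>x. f x + g x) (\<lambda>x. f' x + g' x)"
  by (auto simp: has_dd_def intro!: has_vector_derivative_add)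

lemma has_dd_diff:
  "has_dd U e f f' \<Longrightarrow> has_dd U e g g' \<Longrightarrow> has_dd U e (\<lambda>x. f x - g x) (\<lambda>x. f' x - g' x)"
  by (auto simp: has_dd_def intro!: has_vector_derivative_diff)

lemma has_dd_scaleR:
  assumes "has_dd U e g g'" "has_dd U e f f'"
  shows "has_dd U e (\<lambda>x. g x *\<^sub>R f x) (\<lambda>x. g x *\<^sub>R f' x + g' x *\<^sub>R f x)"
  unfolding has_dd_def
proof
  fix x assume "x \<in> U"
  then have "((\<lambda>h. g (x + h *\<^sub>R e)) has_vector_derivative g' x) (at 0)"
    "((\<lambda>h. f (x + h *\<^sub>R e)) has_vector_derivative f' x) (at 0)"
    using assms by (auto simp: has_dd_def)
  then show "((\<lambda>h. g (x + h *\<^sub>R e) *\<^sub>R f (x + h *\<^sub>R e)) has_vector_derivative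
      g x *\<^sub>R f' x + g' x *\<^sub>R f x) (at 0)"
    using has_vector_derivative_scaleR[of "\<lambda>h. g (x + h *\<^sub>R e)" "g' x" 0 UNIV "\<lambda>h. f (x + h *\<^sub>R e)" "f' x"]
    by (simp add: has_real_derivative_iff_has_vector_derivative)
qed

abbreviation e\<^sub>t :: coords where "e\<^sub>t \<equiv> (1, 0, 0, 0)"
abbreviation e\<^sub>r :: coords where "e\<^sub>r \<equiv> (0, 1, 0, 0)"
abbreviation e\<^sub>\<theta> :: coords where "e\<^sub>\<theta> \<equiv> (0, 0, 1, 0)"
abbreviation e\<^sub>\<phi> :: coords where "e\<^sub>\<phi> \<equiv> (0, 0, 0, 1)"

text \<open>Links \<open>has_dd\<close>, which differentiates at parameter 0, to the coordinate
  derivatives, which are taken at the coordinate value itself.\<close>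

lemma has_vector_derivative_shift_zero:
  "((\<lambda>h. f (t + h)) has_vector_derivative D) (at 0) \<Longrightarrow> (f has_vector_derivative D) (at (t::real))"
  using vector_diff_chain_at[of "\<lambda>x. x - t" 1 t "\<lambda>h. f (t + h)" D]
    has_vector_derivative_diff[OF has_vector_derivative_id has_vector_derivative_const, of t "at t"]
  by (simp add: o_def)

lemma D\<^sub>t_eq: "has_dd U e\<^sub>t f f' \<Longrightarrow> x \<in> U \<Longrightarrow> D\<^sub>t f x = f' x"
  by (cases x) (fastforce simp: has_dd_def intro: vector_derivative_at[OF has_vector_derivative_shift_zero])

lemma D\<^sub>r_eq: "has_dd U e\<^sub>r f f' \<Longrightarrow> x \<in> U \<Longrightarrow> D\<^sub>r f x = f' x"
  by (cases x) (fastforce simp: has_dd_def intro: vector_derivative_at[OF has_vector_derivative_shift_zero])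

lemma D\<^sub>\<theta>_eq: "has_dd U e\<^sub>\<theta> f f' \<Longrightarrow> x \<in> U \<Longrightarrow> D\<^sub>\<theta> f x = f' x"
  by (cases x) (fastforce simp: has_dd_def intro: vector_derivative_at[OF has_vector_derivative_shift_zero])

lemma D\<^sub>\<phi>_eq: "has_dd U e\<^sub>\<phi> f f' \<Longrightarrow> x \<in> U \<Longrightarrow> D\<^sub>\<phi> f x = f' x"
  by (cases x) (fastforce simp: has_dd_def intro: vector_derivative_at[OF has_vector_derivative_shift_zero])

lemma has_dd_radial:
  assumes "\<And>t r \<theta> \<phi>. (t, r, \<theta>, \<phi>) \<in> U \<Longrightarrow> (g has_vector_derivative g' r) (at r)"
  shows "has_dd U e\<^sub>r (\<lambda>(t, r, \<theta>, \<phi>). g r) (\<lambda>(t, r, \<theta>, \<phi>). g' r)"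
  unfolding has_dd_def
proof clarify
  fix t r \<theta> \<phi> assume "(t, r, \<theta>, \<phi>) \<in> U"
  then have "((g \<circ> (\<lambda>h. r + h)) has_vector_derivative (1 *\<^sub>R g' r)) (at 0)"
    by (intro vector_diff_chain_at) (auto intro!: derivative_eq_intros assms)
  then show "((\<lambda>h. case (t, r, \<theta>, \<phi>) + h *\<^sub>R e\<^sub>r of (t, r, \<theta>, \<phi>) \<Rightarrow> g r) has_vector_derivative g' r) (at 0)"
    by (simp add: o_def)
qed

lemma has_dd_polar:
  assumes "\<And>t r \<theta> \<phi>. (t, r, \<theta>, \<phi>) \<in> U \<Longrightarrow> (g has_vector_derivative g' \<theta>) (at \<theta>)"
  shows "has_dd U e\<^sub>\<theta> (\<lambda>(t, r, \<theta>, \<phi>). g \<theta>) (\<lambda>(t, r, \<theta>, \<phi>). g' \<theta>)"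
  unfolding has_dd_def
proof clarify
  fix t r \<theta> \<phi> assume "(t, r, \<theta>, \<phi>) \<in> U"
  then have "((g \<circ> (\<lambda>h. \<theta> + h)) has_vector_derivative (1 *\<^sub>R g' \<theta>)) (at 0)"
    by (intro vector_diff_chain_at) (auto intro!: derivative_eq_intros assms)
  then show "((\<lambda>h. case (t, r, \<theta>, \<phi>) + h *\<^sub>R e\<^sub>\<theta> of (t, r, \<theta>, \<phi>) \<Rightarrow> g \<theta>) has_vector_derivative g' \<theta>) (at 0)"
    by (simp add: o_def)
qed

lemma has_dd_const_factor:
  assumes "has_dd U e f f'" "\<And>x h. g (x + h *\<^sub>R e) = g x"
  shows "has_dd U e (\<lambda>x. g x *\<^sub>R f x) (\<lambda>x. g x *\<^sub>R f' x)"
  using assms unfolding has_dd_def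
  by (simp add: bounded_linear.has_vector_derivative[OF bounded_linear_scaleR_right])

subsection \<open>The operators in terms of second-order jets\<close>

text \<open>\<open>dd e' e\<close> is the \<open>e'\<close>-derivative of the \<open>e\<close>-derivative \<open>d e\<close>.\<close>

definition has_jet ::
    "coords set \<Rightarrow> cfun \<Rightarrow> (coords \<Rightarrow> cfun) \<Rightarrow> (coords \<Rightarrow> coords \<Rightarrow> cfun) \<Rightarrow> bool" where
  "has_jet U f d dd \<longleftrightarrow> open U \<and> (\<forall>e\<in>{e\<^sub>t, e\<^sub>r, e\<^sub>\<theta>, e\<^sub>\<phi>}. has_dd U e f (d e) \<and>
     (\<forall>e'\<in>{e\<^sub>t, e\<^sub>r, e\<^sub>\<theta>, e\<^sub>\<phi>}. has_dd U e' (d e) (dd e' e)))"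

lemma has_dd_nonradial_scaleR:
  assumes "has_dd U (a, 0, b, c) f f'"
  shows "has_dd U (a, 0, b, c) (\<lambda>(t, r, \<theta>, \<phi>). g r *\<^sub>R f (t, r, \<theta>, \<phi>))
    (\<lambda>(t, r, \<theta>, \<phi>). g r *\<^sub>R f' (t, r, \<theta>, \<phi>))"
  using has_dd_const_factor[OF assms, of "\<lambda>(t, r, \<theta>, \<phi>). g r"]
  by (simp add: case_prod_unfold)

lemma has_dd_radial_scaleR:
  assumes "has_dd U e\<^sub>r f f'"
    and "\<And>t r \<theta> \<phi>. (t, r, \<theta>, \<phi>) \<in> U \<Longrightarrow> (g has_vector_derivative g' r) (at r)"
  shows "has_dd U e\<^sub>r (\<lambda>(t, r, \<theta>, \<phi>). g r *\<^sub>R f (t, r, \<theta>, \<phi>))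
    (\<lambda>(t, r, \<theta>, \<phi>). g r *\<^sub>R f' (t, r, \<theta>, \<phi>) + g' r *\<^sub>R f (t, r, \<theta>, \<phi>))"
  using has_dd_scaleR[OF has_dd_radial[OF assms(2)] assms(1)] by (simp add: case_prod_unfold)

lemma has_dd_polar_scaleR:
  assumes "has_dd U e\<^sub>\<theta> f f'"
    and "\<And>t r \<theta> \<phi>. (t, r, \<theta>, \<phi>) \<in> U \<Longrightarrow> (g has_vector_derivative g' \<theta>) (at \<theta>)"
  shows "has_dd U e\<^sub>\<theta> (\<lambda>(t, r, \<theta>, \<phi>). g \<theta> *\<^sub>R f (t, r, \<theta>, \<phi>))
    (\<lambda>(t, r, \<theta>, \<phi>). g \<theta> *\<^sub>R f' (t, r, \<theta>, \<phi>) + g' \<theta> *\<^sub>R f (t, r, \<theta>, \<phi>))"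
  using has_dd_scaleR[OF has_dd_polar[OF assms(2)] assms(1)] by (simp add: case_prod_unfold)

lemma has_jet_cong:
  assumes j: "has_jet U f d dd" and fg: "\<And>x. x \<in> U \<Longrightarrow> f x = g x"
  shows "has_jet U g d dd"
proof -
  have "open U"
    using j by (simp add: has_jet_def)
  then have "has_dd U e g f'" if "has_dd U e f f'" for e f'
    by (rule has_dd_cong[OF that]) (simp_all add: fg)
  then show ?thesis
    using j by (simp add: has_jet_def)
qed

lemma has_jet_subset:
  assumes "has_jet U f d dd" "open V" "V \<subseteq> U"
  shows "has_jet V f d dd"
  using assms by (simp add: has_jet_def has_dd_subset[of U _ _ _ V])

lemma has_jet_first:
  assumes "has_jet U f d dd" "x \<in> U"
  shows "D\<^sub>t f x = d e\<^sub>t x" "D\<^sub>r f x = d e\<^sub>r x" "D\<^sub>\<theta> f x = d e\<^sub>\<theta> x" "D\<^sub>\<phi> f x = d e\<^sub>\<phi> x"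
proof -
  have "has_dd U e\<^sub>t f (d e\<^sub>t)" "has_dd U e\<^sub>r f (d e\<^sub>r)" "has_dd U e\<^sub>\<theta> f (d e\<^sub>\<theta>)" "has_dd U e\<^sub>\<phi> f (d e\<^sub>\<phi>)"
    using assms(1) by (simp_all add: has_jet_def)
  then show "D\<^sub>t f x = d e\<^sub>t x" "D\<^sub>r f x = d e\<^sub>r x" "D\<^sub>\<theta> f x = d e\<^sub>\<theta> x" "D\<^sub>\<phi> f x = d e\<^sub>\<phi> x"
    using assms(2) by (blast intro: D\<^sub>t_eq D\<^sub>r_eq D\<^sub>\<theta>_eq D\<^sub>\<phi>_eq)+
qed

text \<open>The operators nest coordinate derivatives, and the inner one is known to agree with the
  jet only on U. As U is open, the agreement holds near each point, so the outer derivative can be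
  read off the jet.\<close>

lemma has_jet_second:
  assumes "has_jet U f d dd" "e \<in> {e\<^sub>t, e\<^sub>r, e\<^sub>\<theta>, e\<^sub>\<phi>}"
  shows "has_dd U e (D\<^sub>t f) (dd e e\<^sub>t)" "has_dd U e (D\<^sub>r f) (dd e e\<^sub>r)"
    "has_dd U e (D\<^sub>\<theta> f) (dd e e\<^sub>\<theta>)" "has_dd U e (D\<^sub>\<phi> f) (dd e e\<^sub>\<phi>)"
proof -
  have *: "has_dd U e g (dd e e')" if "\<And>x. x \<in> U \<Longrightarrow> g x = d e' x" "e' \<in> {e\<^sub>t, e\<^sub>r, e\<^sub>\<theta>, e\<^sub>\<phi>}" for e' g
  proof (rule has_dd_cong)
    show "has_dd U e (d e') (dd e e')" "open U"
      using assms that by (auto simp: has_jet_def)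
  qed (use that in auto)
  show "has_dd U e (D\<^sub>t f) (dd e e\<^sub>t)" "has_dd U e (D\<^sub>r f) (dd e e\<^sub>r)"
    "has_dd U e (D\<^sub>\<theta> f) (dd e e\<^sub>\<theta>)" "has_dd U e (D\<^sub>\<phi> f) (dd e e\<^sub>\<phi>)"
    by (rule *; simp add: has_jet_first[OF assms(1)])+
qed

text \<open>The factor 1 / sin \<theta> is deliberately not multiplied out: the same expression
  appears in the Kerr operator and in the transformed one and can later be folded into a single
  symbol.\<close>

lemma ang_op_eq:
  assumes j: "has_jet U f d dd" and x: "(t, r, \<theta>, \<phi>) \<in> U"
  shows "ang_op a f (t, r, \<theta>, \<phi>) =
     (1 / sin \<theta>) *\<^sub>R (sin \<theta> *\<^sub>R dd e\<^sub>\<theta> e\<^sub>\<theta> (t, r, \<theta>, \<phi>) + cos \<theta> *\<^sub>R d e\<^sub>\<theta> (t, r, \<theta>, \<phi>))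
   + (1 / (sin \<theta>)\<^sup>2) *\<^sub>R dd e\<^sub>\<phi> e\<^sub>\<phi> (t, r, \<theta>, \<phi>)
   + (2 * a) *\<^sub>R dd e\<^sub>t e\<^sub>\<phi> (t, r, \<theta>, \<phi>)
   + (a\<^sup>2 * (sin \<theta>)\<^sup>2) *\<^sub>R dd e\<^sub>t e\<^sub>t (t, r, \<theta>, \<phi>)"
proof -
  have "has_dd U e\<^sub>\<theta> (\<lambda>(t, r, \<theta>, \<phi>). sin \<theta> *\<^sub>R D\<^sub>\<theta> f (t, r, \<theta>, \<phi>))
    (\<lambda>(t, r, \<theta>, \<phi>). sin \<theta> *\<^sub>R dd e\<^sub>\<theta> e\<^sub>\<theta> (t, r, \<theta>, \<phi>) + cos \<theta> *\<^sub>R D\<^sub>\<theta> f (t, r, \<theta>, \<phi>))"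
    by (rule has_dd_polar_scaleR[OF has_jet_second(3)[OF j]])
      (auto intro!: derivative_eq_intros simp flip: has_real_derivative_iff_has_vector_derivative)
  note sq = D\<^sub>\<theta>_eq[OF this x]
  show ?thesis
    by (simp add: sq has_jet_first[OF j x] D\<^sub>\<phi>_eq[OF has_jet_second(4)[OF j] x]
        D\<^sub>t_eq[OF has_jet_second(4)[OF j] x] D\<^sub>t_eq[OF has_jet_second(1)[OF j] x] del: D\<^sub>\<theta>.simps D\<^sub>t.simps D\<^sub>\<phi>.simps)
qed

lemma wave_op_eq:
  assumes j: "has_jet U f d dd" and x: "(t, r, \<theta>, \<phi>) \<in> U"
  shows "wave_op m a f (t, r, \<theta>, \<phi>) =
     Delta m a r *\<^sub>R dd e\<^sub>r e\<^sub>r (t, r, \<theta>, \<phi>) + (2 * (r - m)) *\<^sub>R d e\<^sub>r (t, r, \<theta>, \<phi>)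
   - (r\<^sup>2 + a\<^sup>2) *\<^sub>R dd e\<^sub>t e\<^sub>r (t, r, \<theta>, \<phi>)
   - ((r\<^sup>2 + a\<^sup>2) *\<^sub>R dd e\<^sub>r e\<^sub>t (t, r, \<theta>, \<phi>) + (2 * r) *\<^sub>R d e\<^sub>t (t, r, \<theta>, \<phi>))
   - (2 * a) *\<^sub>R dd e\<^sub>r e\<^sub>\<phi> (t, r, \<theta>, \<phi>)
   + ang_op a f (t, r, \<theta>, \<phi>)"
proof -
  have "has_dd U e\<^sub>r (\<lambda>(t, r, \<theta>, \<phi>). Delta m a r *\<^sub>R D\<^sub>r f (t, r, \<theta>, \<phi>))
    (\<lambda>(t, r, \<theta>, \<phi>). Delta m a r *\<^sub>R dd e\<^sub>r e\<^sub>r (t, r, \<theta>, \<phi>) + (2 * (r - m)) *\<^sub>R D\<^sub>r f (t, r, \<theta>, \<phi>))"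
    by (rule has_dd_radial_scaleR[OF has_jet_second(2)[OF j]])
      (auto intro!: derivative_eq_intros simp: Delta_def[abs_def] simp flip: has_real_derivative_iff_has_vector_derivative)
  note rr = D\<^sub>r_eq[OF this x]
  have "has_dd U e\<^sub>r (\<lambda>(t, r, \<theta>, \<phi>). (r\<^sup>2 + a\<^sup>2) *\<^sub>R D\<^sub>t f (t, r, \<theta>, \<phi>))
    (\<lambda>(t, r, \<theta>, \<phi>). (r\<^sup>2 + a\<^sup>2) *\<^sub>R dd e\<^sub>r e\<^sub>t (t, r, \<theta>, \<phi>) + (2 * r) *\<^sub>R D\<^sub>t f (t, r, \<theta>, \<phi>))"
    by (rule has_dd_radial_scaleR[OF has_jet_second(1)[OF j]])
      (auto intro!: derivative_eq_intros simp flip: has_real_derivative_iff_has_vector_derivative)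
  note rt = D\<^sub>r_eq[OF this x]
  have "has_dd U e\<^sub>t (\<lambda>(t, r, \<theta>, \<phi>). (r\<^sup>2 + a\<^sup>2) *\<^sub>R D\<^sub>r f (t, r, \<theta>, \<phi>))
    (\<lambda>(t, r, \<theta>, \<phi>). (r\<^sup>2 + a\<^sup>2) *\<^sub>R dd e\<^sub>t e\<^sub>r (t, r, \<theta>, \<phi>))"
    by (rule has_dd_nonradial_scaleR[OF has_jet_second(2)[OF j]]) simp
  note tr = D\<^sub>t_eq[OF this x]
  show ?thesis
    by (simp add: rr rt tr has_jet_first[OF j x] D\<^sub>r_eq[OF has_jet_second(4)[OF j] x]
         del: D\<^sub>r.simps D\<^sub>t.simps D\<^sub>\<phi>.simps ang_op.simps)
qed

section \<open>The transformed wave operator in coordinates\<close>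

lemma htilde_component:
  "htilde m a S R R' 1 1 = (\<lambda>(v, r, \<theta>, \<phi>). Xfun S R' r * (Xfun S R' r + 2) / S\<^sup>2)"
  "htilde m a S R R' 0 1 = (\<lambda>(v, r, \<theta>, \<phi>). ((R - m) * (Xfun S R' r)\<^sup>2 + 2 * R * Xfun S R' r) / S)"
  "htilde m a S R R' 1 0 = (\<lambda>(v, r, \<theta>, \<phi>). ((R - m) * (Xfun S R' r)\<^sup>2 + 2 * R * Xfun S R' r) / S)"
  "htilde m a S R R' 0 0 = (\<lambda>(v, r, \<theta>, \<phi>). Delta m a R * (Xfun S R' r)\<^sup>2 + 2 * (R\<^sup>2 + a\<^sup>2) * Xfun S R' r)"
  "htilde m a S R R' 0 3 = (\<lambda>(v, r, \<theta>, \<phi>). a * Xfun S R' r)"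
  "htilde m a S R R' 3 0 = (\<lambda>(v, r, \<theta>, \<phi>). a * Xfun S R' r)"
  by (auto simp: fun_eq_iff Let_def doubleton_eq_iff)

lemma htilde_zero:
  "(\<alpha>, \<beta>) \<in> {(0, 2), (2, 0), (1, 2), (2, 1), (1, 3), (3, 1), (2, 2), (2, 3), (3, 2), (3, 3)} \<Longrightarrow>
    htilde m a S R R' \<alpha> \<beta> = (\<lambda>x. 0)"
  by (auto simp: fun_eq_iff Let_def doubleton_eq_iff)

lemma pd_simps: "pd 0 = D\<^sub>t" "pd 1 = D\<^sub>r" "pd 2 = D\<^sub>\<theta>" "pd 3 = D\<^sub>\<phi>"
  by (simp_all add: pd_def numeral_eq_Suc)

lemma pd_zero: "\<alpha> < 4 \<Longrightarrow> pd \<alpha> (\<lambda>x. 0) x = 0"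
  by (cases x) (auto simp: less_Suc_eq numeral_eq_Suc pd_def)

lemma wave_op_tilde_sum:
  "wave_op_tilde m a S R R' f x =
     D\<^sub>r (\<lambda>(v, r, \<theta>, \<phi>). (Xfun S R' r * (Xfun S R' r + 2) / S\<^sup>2) *\<^sub>R D\<^sub>r f (v, r, \<theta>, \<phi>)) x
   + D\<^sub>t (\<lambda>(v, r, \<theta>, \<phi>). (((R - m) * (Xfun S R' r)\<^sup>2 + 2 * R * Xfun S R' r) / S) *\<^sub>R D\<^sub>r f (v, r, \<theta>, \<phi>)) x
   + D\<^sub>r (\<lambda>(v, r, \<theta>, \<phi>). (((R - m) * (Xfun S R' r)\<^sup>2 + 2 * R * Xfun S R' r) / S) *\<^sub>R D\<^sub>t f (v, r, \<theta>, \<phi>)) x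
   + D\<^sub>t (\<lambda>(v, r, \<theta>, \<phi>). (Delta m a R * (Xfun S R' r)\<^sup>2 + 2 * (R\<^sup>2 + a\<^sup>2) * Xfun S R' r) *\<^sub>R D\<^sub>t f (v, r, \<theta>, \<phi>)) x
   + D\<^sub>t (\<lambda>(v, r, \<theta>, \<phi>). (a * Xfun S R' r) *\<^sub>R D\<^sub>\<phi> f (v, r, \<theta>, \<phi>)) x
   + D\<^sub>\<phi> (\<lambda>(v, r, \<theta>, \<phi>). (a * Xfun S R' r) *\<^sub>R D\<^sub>t f (v, r, \<theta>, \<phi>)) x
   + ang_op a f x"
proof -
  let ?g = "\<lambda>\<alpha> \<beta>. pd \<alpha> (\<lambda>y. htilde m a S R R' \<alpha> \<beta> y *\<^sub>R pd \<beta> f y) x"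
  \<comment> \<open>A zero component makes the inner function vanish identically, so the outer
    derivative is zero whatever \<open>f\<close> is.\<close>
  have z: "?g \<alpha> \<beta> = 0" if "(\<alpha>, \<beta>) \<in> {(0, 2), (2, 0), (1, 2), (2, 1), (1, 3), (3, 1), (2, 2), (2, 3), (3, 2), (3, 3)}" for \<alpha> \<beta>
    unfolding htilde_zero[OF that] scaleR_zero_left using that by (intro pd_zero) auto
  have set4: "{..<4} = {0, 1, 2, 3::nat}"
    by auto
  have "wave_op_tilde m a S R R' f x = ?g 1 1 + ?g 0 1 + ?g 1 0 + ?g 0 0 + ?g 0 3 + ?g 3 0 + ang_op a f x"
    unfolding wave_op_tilde_def set4 by (simp add: z del: One_nat_def)
  then show ?thesis
    unfolding htilde_component pd_simps by (simp only: case_prod_unfold prod.collapse)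
qed

lemma Xfun_deriv: "(Xfun S R' has_real_derivative S) (at r)"
  unfolding Xfun_def[abs_def] by (auto intro!: derivative_eq_intros)

text \<open>First-order terms arise only where the outer derivative is radial. As X has derivative
  S, a factor 1/S is lost there: X (X + 2) / S^2 contributes 2 (X + 1) / S, and the vr component
  contributes 2 (R - m) X + 2 R.\<close>

lemma wave_op_tilde_eq:
  fixes R' :: real
  assumes j: "has_jet U f d dd" and x: "(v, r, \<theta>, \<phi>) \<in> U" and "S \<noteq> 0"
  defines "X \<equiv> Xfun S R' r"
  shows "wave_op_tilde m a S R R' f (v, r, \<theta>, \<phi>) =
     (X * (X + 2) / S\<^sup>2) *\<^sub>R dd e\<^sub>r e\<^sub>r (v, r, \<theta>, \<phi>) + (2 * (X + 1) / S) *\<^sub>R d e\<^sub>r (v, r, \<theta>, \<phi>)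
   + (((R - m) * X\<^sup>2 + 2 * R * X) / S) *\<^sub>R (dd e\<^sub>t e\<^sub>r (v, r, \<theta>, \<phi>) + dd e\<^sub>r e\<^sub>t (v, r, \<theta>, \<phi>))
   + (2 * (R - m) * X + 2 * R) *\<^sub>R d e\<^sub>t (v, r, \<theta>, \<phi>)
   + (Delta m a R * X\<^sup>2 + 2 * (R\<^sup>2 + a\<^sup>2) * X) *\<^sub>R dd e\<^sub>t e\<^sub>t (v, r, \<theta>, \<phi>)
   + (a * X) *\<^sub>R (dd e\<^sub>t e\<^sub>\<phi> (v, r, \<theta>, \<phi>) + dd e\<^sub>\<phi> e\<^sub>t (v, r, \<theta>, \<phi>))
   + ang_op a f (v, r, \<theta>, \<phi>)"
proof -
  note [derivative_intros] = DERIV_chain2[OF Xfun_deriv]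
  have "has_dd U e\<^sub>r (\<lambda>(v, r, \<theta>, \<phi>). (Xfun S R' r * (Xfun S R' r + 2) / S\<^sup>2) *\<^sub>R D\<^sub>r f (v, r, \<theta>, \<phi>))
    (\<lambda>(v, r, \<theta>, \<phi>). (Xfun S R' r * (Xfun S R' r + 2) / S\<^sup>2) *\<^sub>R dd e\<^sub>r e\<^sub>r (v, r, \<theta>, \<phi>)
      + (2 * (Xfun S R' r + 1) / S) *\<^sub>R D\<^sub>r f (v, r, \<theta>, \<phi>))"
    by (rule has_dd_radial_scaleR[OF has_jet_second(2)[OF j]])
      (use \<open>S \<noteq> 0\<close> in \<open>auto intro!: derivative_eq_intros
        simp: field_simps power2_eq_square simp flip: has_real_derivative_iff_has_vector_derivative\<close>)
  note rr = D\<^sub>r_eq[OF this x]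
  have "has_dd U e\<^sub>r (\<lambda>(v, r, \<theta>, \<phi>). (((R - m) * (Xfun S R' r)\<^sup>2 + 2 * R * Xfun S R' r) / S) *\<^sub>R D\<^sub>t f (v, r, \<theta>, \<phi>))
    (\<lambda>(v, r, \<theta>, \<phi>). (((R - m) * (Xfun S R' r)\<^sup>2 + 2 * R * Xfun S R' r) / S) *\<^sub>R dd e\<^sub>r e\<^sub>t (v, r, \<theta>, \<phi>)
      + (2 * (R - m) * Xfun S R' r + 2 * R) *\<^sub>R D\<^sub>t f (v, r, \<theta>, \<phi>))"
    by (rule has_dd_radial_scaleR[OF has_jet_second(1)[OF j]])
      (use \<open>S \<noteq> 0\<close> in \<open>auto intro!: derivative_eq_intros
        simp: field_simps power2_eq_square simp flip: has_real_derivative_iff_has_vector_derivative\<close>)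
  note rt = D\<^sub>r_eq[OF this x]
  have tt: "D\<^sub>t (\<lambda>(v, r, \<theta>, \<phi>). g r *\<^sub>R D\<^sub>t f (v, r, \<theta>, \<phi>)) (v, r, \<theta>, \<phi>) = g r *\<^sub>R dd e\<^sub>t e\<^sub>t (v, r, \<theta>, \<phi>)"
    and tr: "D\<^sub>t (\<lambda>(v, r, \<theta>, \<phi>). g r *\<^sub>R D\<^sub>r f (v, r, \<theta>, \<phi>)) (v, r, \<theta>, \<phi>) = g r *\<^sub>R dd e\<^sub>t e\<^sub>r (v, r, \<theta>, \<phi>)"
    and tp: "D\<^sub>t (\<lambda>(v, r, \<theta>, \<phi>). g r *\<^sub>R D\<^sub>\<phi> f (v, r, \<theta>, \<phi>)) (v, r, \<theta>, \<phi>) = g r *\<^sub>R dd e\<^sub>t e\<^sub>\<phi> (v, r, \<theta>, \<phi>)"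
    and pt: "D\<^sub>\<phi> (\<lambda>(v, r, \<theta>, \<phi>). g r *\<^sub>R D\<^sub>t f (v, r, \<theta>, \<phi>)) (v, r, \<theta>, \<phi>) = g r *\<^sub>R dd e\<^sub>\<phi> e\<^sub>t (v, r, \<theta>, \<phi>)" for g
    using D\<^sub>t_eq[OF has_dd_nonradial_scaleR[OF has_jet_second(1)[OF j]] x]
      D\<^sub>t_eq[OF has_dd_nonradial_scaleR[OF has_jet_second(2)[OF j]] x]
      D\<^sub>t_eq[OF has_dd_nonradial_scaleR[OF has_jet_second(4)[OF j]] x]
      D\<^sub>\<phi>_eq[OF has_dd_nonradial_scaleR[OF has_jet_second(1)[OF j]] x]
    by (simp_all del: D\<^sub>r.simps D\<^sub>t.simps D\<^sub>\<phi>.simps)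
  show ?thesis
    unfolding wave_op_tilde_sum rr rt tt tr tp pt prod.case has_jet_first[OF j x] X_def
    by (simp add: algebra_simps del: ang_op.simps)
qed

section \<open>Conjugation by a power of r' - R'\<close>

lemma has_jet_rescale:
  fixes R' :: real and s :: int
  assumes j: "has_jet U f d dd" and U: "U \<subseteq> {(v, r, \<theta>, \<phi>). r \<noteq> R'}"
  defines "g \<equiv> \<lambda>r. (r - R') powi (- s)"
    and "g' \<equiv> \<lambda>r. - of_int s * (r - R') powi (- s - 1)"
    and "g'' \<equiv> \<lambda>r. of_int s * (of_int s + 1) * (r - R') powi (- s - 2)"
  shows "has_jet U (rescale R' s f)
    (\<lambda>e (v, r, \<theta>, \<phi>). g r *\<^sub>R d e (v, r, \<theta>, \<phi>) + (if e = e\<^sub>r then g' r else 0) *\<^sub>R f (v, r, \<theta>, \<phi>))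
    (\<lambda>e' e (v, r, \<theta>, \<phi>). g r *\<^sub>R dd e' e (v, r, \<theta>, \<phi>)
       + (if e = e\<^sub>r then g' r else 0) *\<^sub>R d e' (v, r, \<theta>, \<phi>)
       + (if e' = e\<^sub>r then g' r else 0) *\<^sub>R d e (v, r, \<theta>, \<phi>)
       + (if e = e\<^sub>r \<and> e' = e\<^sub>r then g'' r else 0) *\<^sub>R f (v, r, \<theta>, \<phi>))"
proof -
  \<comment> \<open>Away from r = R' an integer power is differentiable for negative exponents
    too.\<close>
  have g: "(g has_vector_derivative g' r) (at r)"
    and g': "(g' has_vector_derivative g'' r) (at r)" if "(v, r, \<theta>, \<phi>) \<in> U" for v r \<theta> \<phi>
    using U that unfolding g_def g'_def g''_def
    by (auto intro!: derivative_eq_intros simp: algebra_simps simp flip: has_real_derivative_iff_has_vector_derivative)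
  have mult: "has_dd U e (\<lambda>(v, r, \<theta>, \<phi>). k r *\<^sub>R w (v, r, \<theta>, \<phi>))
    (\<lambda>(v, r, \<theta>, \<phi>). k r *\<^sub>R w' (v, r, \<theta>, \<phi>) + (if e = e\<^sub>r then k' r else 0) *\<^sub>R w (v, r, \<theta>, \<phi>))"
    if "has_dd U e w w'" "e \<in> {e\<^sub>t, e\<^sub>r, e\<^sub>\<theta>, e\<^sub>\<phi>}"
      "\<And>v r \<theta> \<phi>. (v, r, \<theta>, \<phi>) \<in> U \<Longrightarrow> (k has_vector_derivative k' r) (at r)" for k k' w w' e
    using that has_dd_radial_scaleR[of U w w' k k'] has_dd_nonradial_scaleR[of U _ _ _ w w' k]
    by (auto simp: case_prod_unfold)
  have resc: "rescale R' s f = (\<lambda>(v, r, \<theta>, \<phi>). g r *\<^sub>R f (v, r, \<theta>, \<phi>))"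
    by (auto simp: fun_eq_iff g_def)
  show ?thesis
    unfolding has_jet_def
  proof (intro conjI ballI)
    show "open U"
      using j by (simp add: has_jet_def)
  next
    fix e :: coords assume e: "e \<in> {e\<^sub>t, e\<^sub>r, e\<^sub>\<theta>, e\<^sub>\<phi>}"
    show "has_dd U e (rescale R' s f) (\<lambda>(v, r, \<theta>, \<phi>). g r *\<^sub>R d e (v, r, \<theta>, \<phi>) + (if e = e\<^sub>r then g' r else 0) *\<^sub>R f (v, r, \<theta>, \<phi>))"
      unfolding resc by (rule mult[OF _ e g]) (use j e in \<open>auto simp: has_jet_def\<close>)
    fix e' :: coords assume e': "e' \<in> {e\<^sub>t, e\<^sub>r, e\<^sub>\<theta>, e\<^sub>\<phi>}"
    have 1: "has_dd U e' (\<lambda>(v, r, \<theta>, \<phi>). g r *\<^sub>R d e (v, r, \<theta>, \<phi>))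
       (\<lambda>(v, r, \<theta>, \<phi>). g r *\<^sub>R dd e' e (v, r, \<theta>, \<phi>) + (if e' = e\<^sub>r then g' r else 0) *\<^sub>R d e (v, r, \<theta>, \<phi>))"
      by (rule mult[OF _ e' g]) (use j e e' in \<open>auto simp: has_jet_def\<close>)
    \<comment> \<open>This summand enters only for \<open>e = e\<^sub>r\<close>; in the other
      directions \<open>f\<close> has coefficient 0 and \<open>1\<close> alone gives the
      claim.\<close>
    have 2: "has_dd U e' (\<lambda>(v, r, \<theta>, \<phi>). g' r *\<^sub>R f (v, r, \<theta>, \<phi>))
       (\<lambda>(v, r, \<theta>, \<phi>). g' r *\<^sub>R d e' (v, r, \<theta>, \<phi>) + (if e' = e\<^sub>r then g'' r else 0) *\<^sub>R f (v, r, \<theta>, \<phi>))"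
      by (rule mult[OF _ e' g']) (use j e' in \<open>auto simp: has_jet_def\<close>)
    show "has_dd U e' (\<lambda>(v, r, \<theta>, \<phi>). g r *\<^sub>R d e (v, r, \<theta>, \<phi>) + (if e = e\<^sub>r then g' r else 0) *\<^sub>R f (v, r, \<theta>, \<phi>))
      (\<lambda>(v, r, \<theta>, \<phi>). g r *\<^sub>R dd e' e (v, r, \<theta>, \<phi>)
       + (if e = e\<^sub>r then g' r else 0) *\<^sub>R d e' (v, r, \<theta>, \<phi>)
       + (if e' = e\<^sub>r then g' r else 0) *\<^sub>R d e (v, r, \<theta>, \<phi>)
       + (if e = e\<^sub>r \<and> e' = e\<^sub>r then g'' r else 0) *\<^sub>R f (v, r, \<theta>, \<phi>))"
      using has_dd_add[OF 1 2] 1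
      by (cases "e = e\<^sub>r"; cases "e' = e\<^sub>r") (simp_all add: case_prod_unfold add_ac)
  qed
qed

text \<open>The angular operator has no radial derivative, hence commutes with a weight in
  r.\<close>

lemma ang_op_rescale:
  assumes j: "has_jet U f d dd" and x: "(v, r, \<theta>, \<phi>) \<in> U"
    and U: "U \<subseteq> {(v, r, \<theta>, \<phi>). r \<noteq> R'}"
  shows "ang_op a (rescale R' s f) (v, r, \<theta>, \<phi>) = ((r - R') powi (- s)) *\<^sub>R ang_op a f (v, r, \<theta>, \<phi>)"
  unfolding ang_op_eq[OF j x] ang_op_eq[OF has_jet_rescale[OF j U] x]
  by (simp add: algebra_simps del: ang_op.simps rescale.simps)

text \<open>For g = y^(-s) with y = r - R' one has g'/g = -s/y and X = S y. Hence the cross terms 2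
  A g' and 2 C g' are g times the real first-order coefficients of \<open>teukolsky_tilde\<close>,
  which is what singles out the exponent -s. The zeroth-order remainder A g'' + B g' equals g (s (s
  + 1) (X + 2) - 2 s (X + 1)) / X = g (s^2 (1 + 2/X) - s).\<close>

lemma wave_op_tilde_rescale:
  fixes s :: int
  assumes j: "has_jet U f d dd" and x: "(v, r, \<theta>, \<phi>) \<in> U" and "S \<noteq> 0"
    and U: "U \<subseteq> {(v, r, \<theta>, \<phi>). r \<noteq> R'}"
  defines "X \<equiv> Xfun S R' r"
  shows "wave_op_tilde m a S R R' (rescale R' s f) (v, r, \<theta>, \<phi>) = ((r - R') powi (- s)) *\<^sub>R
     (wave_op_tilde m a S R R' f (v, r, \<theta>, \<phi>)
      - (2 * of_int s / S * (X + 2)) *\<^sub>R d e\<^sub>r (v, r, \<theta>, \<phi>)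
      - (2 * of_int s * ((R - m) * X + 2 * R)) *\<^sub>R d e\<^sub>t (v, r, \<theta>, \<phi>)
      + ((of_int s)\<^sup>2 * (1 + 2 / X) - of_int s) *\<^sub>R f (v, r, \<theta>, \<phi>))"
proof -
  define y where "y = r - R'"
  define g g1 g2 where "g = y powi (- s)" and "g1 = - of_int s * y powi (- s - 1)"
    and "g2 = of_int s * (of_int s + 1) * y powi (- s - 2)"
  define A B C where "A = X * (X + 2) / S\<^sup>2" and "B = 2 * (X + 1) / S"
    and "C = ((R - m) * X\<^sup>2 + 2 * R * X) / S"
  have y: "y \<noteq> 0" and X: "X = S * y"
    using U x by (auto simp: y_def X_def Xfun_def)
  \<comment> \<open>Expressing both derivatives through g and y turns \<open>1\<close>,
    \<open>2\<close> and \<open>3\<close> into field arithmetic.\<close>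
  have g1: "g1 = - of_int s * g / y" and g2: "g2 = of_int s * (of_int s + 1) * g / y\<^sup>2"
    using y by (auto simp: g_def g1_def g2_def power_int_diff power2_eq_square)
  have 1: "2 * (A * g1) = - (g * (2 * of_int s / S * (X + 2)))"
    and 2: "A * g2 + B * g1 = g * ((of_int s)\<^sup>2 * (1 + 2 / X) - of_int s)"
    and 3: "2 * (C * g1) = - (g * (2 * of_int s * ((R - m) * X + 2 * R)))"
    using y \<open>S \<noteq> 0\<close> unfolding A_def B_def C_def g1 g2 X
    by (simp_all add: divide_simps power2_eq_square) (simp_all add: algebra_simps)
  \<comment> \<open>A pure regrouping with the jet entries as free variables; the three coefficient
    groups at the end are the left sides of \<open>1\<close>, \<open>2\<close> and
    \<open>3\<close>.\<close>
  have *: "A *\<^sub>R (g *\<^sub>R drr + g1 *\<^sub>R dr + g1 *\<^sub>R dr + g2 *\<^sub>R w) + B *\<^sub>R (g *\<^sub>R dr + g1 *\<^sub>R w)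
      + C *\<^sub>R (g *\<^sub>R dtr + g1 *\<^sub>R dt + (g *\<^sub>R drt + g1 *\<^sub>R dt)) + E *\<^sub>R (g *\<^sub>R dt)
      + H *\<^sub>R (g *\<^sub>R dtt) + J *\<^sub>R (g *\<^sub>R dtp + g *\<^sub>R dpt) + g *\<^sub>R ang
      = g *\<^sub>R (A *\<^sub>R drr + B *\<^sub>R dr + C *\<^sub>R (dtr + drt) + E *\<^sub>R dt + H *\<^sub>R dtt + J *\<^sub>R (dtp + dpt) + ang)
        + (2 * (A * g1)) *\<^sub>R dr + (A * g2 + B * g1) *\<^sub>R w + (2 * (C * g1)) *\<^sub>R dt"
    for E H J :: real and drr dr w dtr dt drt dtt dtp dpt ang :: complex
    by (simp add: scaleR_conv_of_real algebra_simps)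
  show ?thesis
    unfolding wave_op_tilde_eq[OF j x \<open>S \<noteq> 0\<close>] wave_op_tilde_eq[OF has_jet_rescale[OF j U] x \<open>S \<noteq> 0\<close>]
      ang_op_rescale[OF j x U] X_def[symmetric] y_def[symmetric] prod.case
    unfolding A_def[symmetric] B_def[symmetric] C_def[symmetric] g_def[symmetric] g1_def[symmetric] g2_def[symmetric]
    by (rule trans[OF _ trans[OF *[of "dd e\<^sub>r e\<^sub>r (v, r, \<theta>, \<phi>)" "d e\<^sub>r (v, r, \<theta>, \<phi>)" "f (v, r, \<theta>, \<phi>)"
      "dd e\<^sub>t e\<^sub>r (v, r, \<theta>, \<phi>)" "d e\<^sub>t (v, r, \<theta>, \<phi>)" "dd e\<^sub>r e\<^sub>t (v, r, \<theta>, \<phi>)"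
      "2 * (R - m) * X + 2 * R" "Delta m a R * X\<^sup>2 + 2 * (R\<^sup>2 + a\<^sup>2) * X" "dd e\<^sub>t e\<^sub>t (v, r, \<theta>, \<phi>)"
      "a * X" "dd e\<^sub>t e\<^sub>\<phi> (v, r, \<theta>, \<phi>)" "dd e\<^sub>\<phi> e\<^sub>t (v, r, \<theta>, \<phi>)" "ang_op a f (v, r, \<theta>, \<phi>)"]]],
        simp del: ang_op.simps, unfold 1 2 3, simp add: algebra_simps del: ang_op.simps)
qed

text \<open>The s^2 (1 + 2/X) created by the conjugation cancels against the potential of
  \<open>P_tilde\<close>, leaving -s - s^2 cot^2 \<theta>; the terms in d_v and d_\<phi> pass
  through the weight.\<close>

lemma P_tilde_rescale:
  assumes j: "has_jet U f d dd" and x: "(v, r, \<theta>, \<phi>) \<in> U" and "S \<noteq> 0"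
    and U: "U \<subseteq> {(v, r, \<theta>, \<phi>). r \<noteq> R'}"
  shows "P_tilde m a S R R' s (rescale R' s f) (v, r, \<theta>, \<phi>)
    = ((r - R') powi (- s)) *\<^sub>R teukolsky_tilde m a S R R' s f (v, r, \<theta>, \<phi>)"
  unfolding P_tilde.simps teukolsky_tilde.simps Let_def wave_op_tilde_rescale[OF j x \<open>S \<noteq> 0\<close> U]
    has_jet_first[OF j x] has_jet_first[OF has_jet_rescale[OF j U] x] prod.case
  by (simp add: scaleR_conv_of_real algebra_simps)

subsection \<open>Moments along the rays of the Whiting transform\<close>

text \<open>The moments are integrated up to \<open>b + 1\<close>, because the support hypothesis says nothing about the
  derivatives of \<open>\<psi>\<close> at \<open>r = b\<close>.\<close>

locale horizon_flat =
  fixes m a b :: real and \<psi> :: cfun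
  assumes smooth: "smooth_on (kerr_exterior m a) \<psi>"
    and horizon: "\<And>vs u \<theta> \<phi>. (u, r_plus m a, \<theta>, \<phi>) \<in> kerr_exterior m a \<Longrightarrow>
           iter_deriv (kerr_exterior m a) vs \<psi> (u, r_plus m a, \<theta>, \<phi>) = 0"
    and support: "\<And>u r \<theta> \<phi>. (u, r, \<theta>, \<phi>) \<in> kerr_exterior m a \<Longrightarrow> b < r \<Longrightarrow> \<psi> (u, r, \<theta>, \<phi>) = 0"
    and b: "r_plus m a \<le> b"
begin

section \<open>Iterated derivatives of \<psi> up to the horizon\<close>

abbreviation "A \<equiv> kerr_exterior m a"

abbreviation F :: "coords list \<Rightarrow> cfun" where
  "F vs \<equiv> iter_deriv A vs \<psi>"

text \<open>The Frechet derivative within A exists at horizon points as well, so curves may start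
  there. Two velocity components are allowed because a ray moves in u and r at once.\<close>

lemma F_chain:
  assumes "(\<gamma> has_vector_derivative \<alpha> *\<^sub>R e + \<beta> *\<^sub>R e') (at t within T)" "\<gamma> ` T \<subseteq> A" "t \<in> T"
  shows "((\<lambda>t. F vs (\<gamma> t)) has_vector_derivative
    \<alpha> *\<^sub>R F (e # vs) (\<gamma> t) + \<beta> *\<^sub>R F (e' # vs) (\<gamma> t)) (at t within T)"
proof -
  let ?D = "frechet_derivative (F vs) (at (\<gamma> t) within A)"
  have D: "(F vs has_derivative ?D) (at (\<gamma> t) within A)"
    using smooth assms by (auto simp: smooth_on_def differentiable_on_def frechet_derivative_works)
  interpret bounded_linear ?D
    by (rule has_derivative_bounded_linear[OF D])
  have "((F vs \<circ> \<gamma>) has_vector_derivative ?D (\<alpha> *\<^sub>R e + \<beta> *\<^sub>R e')) (at t within T)"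
    by (intro vector_derivative_diff_chain_within assms has_derivative_subset[OF D])
  moreover have "?D (\<alpha> *\<^sub>R e + \<beta> *\<^sub>R e') = \<alpha> *\<^sub>R ?D e + \<beta> *\<^sub>R ?D e'"
    by (simp add: add scaleR)
  moreover have "F (w # vs) (\<gamma> t) = ?D w" for w
    by (simp add: iter_deriv_def dir_deriv_def)
  ultimately show ?thesis
    by (simp add: o_def)
qed

text \<open>The speed c becomes S (r - R) when a ray is displaced by varying r'.\<close>

lemma F_line:
  assumes "\<And>h. h \<in> T \<Longrightarrow> x + (h * c) *\<^sub>R e \<in> A" "h \<in> T"
  shows "((\<lambda>h. F vs (x + (h * c) *\<^sub>R e)) has_vector_derivative c *\<^sub>R F (e # vs) (x + (h * c) *\<^sub>R e)) (at h within T)"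
proof -
  have "((\<lambda>h. x + (h * c) *\<^sub>R e) has_vector_derivative c *\<^sub>R e + 0 *\<^sub>R e) (at h within T)"
    by (auto intro!: derivative_eq_intros)
  then have "((\<lambda>h. F vs (x + (h * c) *\<^sub>R e)) has_vector_derivative c *\<^sub>R F (e # vs) (x + (h * c) *\<^sub>R e)
      + 0 *\<^sub>R F (e # vs) (x + (h * c) *\<^sub>R e)) (at h within T)"
    by (rule F_chain) (use assms in \<open>simp_all add: image_subset_iff\<close>)
  then show ?thesis
    by simp
qed

lemma F_continuous: "continuous_on A (F vs)"
  using smooth differentiable_imp_continuous_on unfolding smooth_on_def by blast

definition "exterior_interior = {(u :: real, r, \<theta>, \<phi> :: real). r_plus m a < r \<and> 0 < \<theta> \<and> \<theta> < pi}"

lemma open_exterior_interior: "open exterior_interior"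
proof -
  have "exterior_interior = UNIV \<times> {r_plus m a<..} \<times> {0<..<pi} \<times> UNIV"
    by (auto simp: exterior_interior_def)
  moreover have "open (UNIV \<times> {r_plus m a<..} \<times> {0<..<pi} \<times> UNIV :: coords set)"
    by (intro open_Times) auto
  ultimately show ?thesis
    by metis
qed

lemma exterior_interior_subset: "exterior_interior \<subseteq> A"
  by (auto simp: exterior_interior_def kerr_exterior_def)

text \<open>At interior points the admissible parameters form a neighbourhood of 0, so
  differentiation within A becomes the two-sided one of the coordinate operators.\<close>

lemma F_has_dd: "has_dd exterior_interior e (F vs) (F (e # vs))"
  unfolding has_dd_def
proof
  fix x assume x: "x \<in> exterior_interior"
  let ?T = "(\<lambda>h. x + h *\<^sub>R e) -` exterior_interior"
  have "open ?T"
    by (rule open_line_vimage[OF open_exterior_interior])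
  then have within: "at 0 within ?T = at 0"
    by (rule at_within_open[rotated]) (use x in simp)
  have "((\<lambda>h. F vs (x + (h * 1) *\<^sub>R e)) has_vector_derivative 1 *\<^sub>R F (e # vs) (x + (0 * 1) *\<^sub>R e)) (at 0 within ?T)"
  proof (rule F_line)
    show "x + (h * 1) *\<^sub>R e \<in> A" if "h \<in> ?T" for h
      using that subsetD[OF exterior_interior_subset] by simp
    show "0 \<in> ?T"
      using x by simp
  qed
  then show "((\<lambda>h. F vs (x + h *\<^sub>R e)) has_vector_derivative F (e # vs) x) (at 0)"
    unfolding within by simp
qed

text \<open>The region r > b is open and, as b is at least r_+, avoids the horizon. A function
  vanishing on it has vanishing directional derivatives there, which is the induction step.\<close>

lemma F_support:
  assumes "(u, r, \<theta>, \<phi>) \<in> A" "b < r"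
  shows "F vs (u, r, \<theta>, \<phi>) = 0"
  using assms
proof (induction vs arbitrary: u r \<theta> \<phi>)
  case Nil
  then show ?case
    by (simp add: iter_deriv_def support)
next
  case (Cons e vs)
  let ?U = "UNIV \<times> {b<..} \<times> {0<..<pi} \<times> UNIV :: coords set"
  have "has_dd ?U e (F vs) (F (e # vs))"
    by (rule has_dd_subset[OF F_has_dd]) (use b in \<open>auto simp: exterior_interior_def\<close>)
  moreover have "has_dd ?U e (F vs) (\<lambda>x. 0)"
  proof (rule has_dd_cong[OF has_dd_const])
    show "0 = F vs x" if "x \<in> ?U" for x
      using that b Cons.IH by (cases x) (auto simp: kerr_exterior_def)
  qed (auto intro!: open_Times)
  ultimately have "F (e # vs) (u, r, \<theta>, \<phi>) = (\<lambda>x. 0) (u, r, \<theta>, \<phi>)"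
    by (rule has_dd_unique) (use Cons.prems in \<open>auto simp: kerr_exterior_def\<close>)
  then show ?case .
qed

text \<open>Translations in u and \<phi> preserve A, so the whole plane through x lies in A, even
  for x on the horizon, and the commutation result for functions on the full plane applies.\<close>

lemma F_commute:
  assumes "x \<in> A"
  shows "F (e\<^sub>t # e\<^sub>\<phi> # vs) x = F (e\<^sub>\<phi> # e\<^sub>t # vs) x"
proof -
  have A: "x + s *\<^sub>R e\<^sub>t + y *\<^sub>R e\<^sub>\<phi> \<in> A" for s y
    using assms by (cases x) (auto simp: kerr_exterior_def)
  have A': "x + y *\<^sub>R e\<^sub>\<phi> + s *\<^sub>R e\<^sub>t \<in> A" for s y
    using A by (simp add: ac_simps)
  have t: "((\<lambda>s. F vs (x + s *\<^sub>R e\<^sub>t + y *\<^sub>R e\<^sub>\<phi>)) has_vector_derivative F (e\<^sub>t # vs) (x + s *\<^sub>R e\<^sub>t + y *\<^sub>R e\<^sub>\<phi>)) (at s)" for s y vs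
    using F_line[of UNIV "x + y *\<^sub>R e\<^sub>\<phi>" 1 e\<^sub>t s vs] A' by (simp add: ac_simps)
  have p: "((\<lambda>y. F vs (x + s *\<^sub>R e\<^sub>t + y *\<^sub>R e\<^sub>\<phi>)) has_vector_derivative F (e\<^sub>\<phi> # vs) (x + s *\<^sub>R e\<^sub>t + y *\<^sub>R e\<^sub>\<phi>)) (at y)" for s y vs
    using F_line[of UNIV "x + s *\<^sub>R e\<^sub>t" 1 e\<^sub>\<phi> y vs] A by (simp add: ac_simps)
  have "continuous_on UNIV (\<lambda>(s, y). F (e\<^sub>t # e\<^sub>\<phi> # vs) (x + s *\<^sub>R e\<^sub>t + y *\<^sub>R e\<^sub>\<phi>))"
    unfolding case_prod_unfold
    by (rule continuous_on_compose2[OF F_continuous]) (use A in \<open>auto intro!: continuous_intros\<close>)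
  from mixed_partials_commute[OF t p t p this, of 0 0] show ?thesis
    by (simp flip: zero_prod_def)
qed

section \<open>Moments and their derivatives\<close>

definition ray :: "real \<Rightarrow> real \<Rightarrow> real \<Rightarrow> coords \<Rightarrow> real \<Rightarrow> coords" where
  "ray S R R' = (\<lambda>(v, r', \<theta>, \<phi>) r. (v + Xfun S R' r' * (r - R), r, \<theta>, \<phi>))"

definition strip :: "coords set" where
  "strip = {(v, r', \<theta>, \<phi>). 0 < \<theta> \<and> \<theta> < pi}"

lemma open_strip: "open strip"
proof -
  have "strip = UNIV \<times> UNIV \<times> {0<..<pi} \<times> UNIV"
    by (auto simp: strip_def)
  moreover have "open (UNIV \<times> UNIV \<times> {0<..<pi} \<times> UNIV :: coords set)"
    by (intro open_Times) auto
  ultimately show ?thesis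
    by metis
qed

text \<open>All radial weights are polynomials of degree at most two, so monomials suffice. On a
  compact interval, integrability and differentiation under the integral sign follow from
  continuity.\<close>

definition mom :: "real \<Rightarrow> real \<Rightarrow> real \<Rightarrow> nat \<Rightarrow> coords list \<Rightarrow> cfun" where
  "mom S R R' k vs x = integral {r_plus m a..b + 1} (\<lambda>r. r ^ k *\<^sub>R F vs (ray S R R' x r))"

lemma ray_in_A: "x \<in> strip \<Longrightarrow> r_plus m a \<le> r \<Longrightarrow> ray S R R' x r \<in> A"
  by (cases x) (auto simp: strip_def ray_def kerr_exterior_def)

lemma continuous_ray: 
  "continuous_on T f \<Longrightarrow> continuous_on T g \<Longrightarrow> continuous_on T (\<lambda>z. ray S R R' (f z) (g z))"
  unfolding ray_def case_prod_unfold Xfun_def by ((assumption | rule continuous_intros)+)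

lemma F_ray_continuous:
  assumes "continuous_on T f" "continuous_on T g" "f ` T \<subseteq> strip" "g ` T \<subseteq> {r_plus m a..}"
  shows "continuous_on T (\<lambda>z. F vs (ray S R R' (f z) (g z)))"
proof (rule continuous_on_compose2[OF F_continuous continuous_ray])
  show "(\<lambda>z. ray S R R' (f z) (g z)) ` T \<subseteq> A"
    using assms by (fastforce intro: ray_in_A)
qed (use assms in auto)

lemma mom_has_integral:
  assumes "x \<in> strip"
  shows "((\<lambda>r. r ^ k *\<^sub>R F vs (ray S R R' x r)) has_integral mom S R R' k vs x) {r_plus m a..b + 1}"
  unfolding mom_def
  by (intro integrable_integral integrable_continuous_interval continuous_intros F_ray_continuous)
    (use assms in auto)

text \<open>Covers all coordinate directions at once: c = 1 and e' = e for v, \<theta>, \<phi>,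
  whereas varying r' shifts the ray in u, with c r = S (r - R) and
  \<open>e' = e\<^sub>t\<close>.\<close>

lemma mom_deriv:
  assumes "x \<in> strip" and ray: "\<And>x (h::real) r. ray S R R' (x + h *\<^sub>R e) r = ray S R R' x r + (h * c r) *\<^sub>R e'"
    and c: "continuous_on UNIV c"
  shows "((\<lambda>h. mom S R R' k vs (x + h *\<^sub>R e)) has_vector_derivative
    integral {r_plus m a..b + 1} (\<lambda>r. r ^ k *\<^sub>R c r *\<^sub>R F (e' # vs) (ray S R R' x r))) (at 0)"
proof -
  have "open ((\<lambda>h. x + h *\<^sub>R e) -` strip)" "0 \<in> ((\<lambda>h. x + h *\<^sub>R e) -` strip)"
    using open_line_vimage[OF open_strip] assms(1) by simp_all
  \<comment> \<open>The Leibniz rule works on a convex parameter set. A small ball is convex and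
    keeps the point in \<open>strip\<close>, and the derivative within it at 0 is the full
    derivative.\<close>
  then obtain d where d: "d > 0" "ball (0::real) d \<subseteq> (\<lambda>h. x + h *\<^sub>R e) -` strip"
    by (rule openE)
  then have strip: "x + h *\<^sub>R e \<in> strip" if "h \<in> ball (0::real) d" for h
    using subsetD[OF d(2) that] by simp
  have "((\<lambda>h. integral (cbox (r_plus m a) (b + 1)) (\<lambda>r. r ^ k *\<^sub>R F vs (ray S R R' (x + h *\<^sub>R e) r)))
    has_vector_derivative
    integral (cbox (r_plus m a) (b + 1)) (\<lambda>r. r ^ k *\<^sub>R c r *\<^sub>R F (e' # vs) (ray S R R' (x + 0 *\<^sub>R e) r)))
    (at 0 within ball (0::real) d)"
  proof (rule leibniz_rule_vector_derivative)
    fix h r assume h: "h \<in> ball (0::real) d" and r: "r \<in> cbox (r_plus m a) (b + 1)"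
    have "((\<lambda>h. F vs (ray S R R' x r + (h * c r) *\<^sub>R e')) has_vector_derivative
       c r *\<^sub>R F (e' # vs) (ray S R R' x r + (h * c r) *\<^sub>R e')) (at h within ball (0::real) d)"
    proof (rule F_line[OF _ h])
      show "ray S R R' x r + (h * c r) *\<^sub>R e' \<in> A" if "h \<in> ball 0 d" for h
        unfolding ray[symmetric] by (rule ray_in_A[OF strip[OF that]]) (use r in simp)
    qed
    then show "((\<lambda>h. r ^ k *\<^sub>R F vs (ray S R R' (x + h *\<^sub>R e) r)) has_vector_derivative
       r ^ k *\<^sub>R c r *\<^sub>R F (e' # vs) (ray S R R' (x + h *\<^sub>R e) r)) (at h within ball (0::real) d)"
      unfolding ray by (rule bounded_linear.has_vector_derivative[OF bounded_linear_scaleR_right])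
  next
    show "(\<lambda>r. r ^ k *\<^sub>R F vs (ray S R R' (x + h *\<^sub>R e) r)) integrable_on cbox (r_plus m a) (b + 1)"
      if "h \<in> ball (0::real) d" for h
      using has_integral_integrable[OF mom_has_integral[OF strip[OF that]]] by simp
  next
    have "continuous_on (ball (0::real) d \<times> cbox (r_plus m a) (b + 1)) (\<lambda>z. c (snd z))"
      by (rule continuous_on_compose2[OF c]) (auto intro!: continuous_intros)
    then show "continuous_on (ball (0::real) d \<times> cbox (r_plus m a) (b + 1))
     (\<lambda>(h, r). r ^ k *\<^sub>R c r *\<^sub>R F (e' # vs) (ray S R R' (x + h *\<^sub>R e) r))"
      unfolding case_prod_unfold
      by (intro continuous_intros F_ray_continuous) (simp_all add: image_subset_iff strip)
  qed (use d(1) in simp_all)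
  then show ?thesis
    using d(1) by (simp add: at_within_open[of 0 "ball 0 d"] mom_def)
qed

lemma mom_has_dd:
  assumes "e \<in> {e\<^sub>t, e\<^sub>\<theta>, e\<^sub>\<phi>}"
  shows "has_dd strip e (mom S R R' k vs) (mom S R R' k (e # vs))"
  unfolding has_dd_def
proof
  fix x assume x: "x \<in> strip"
  have "((\<lambda>h. mom S R R' k vs (x + h *\<^sub>R e)) has_vector_derivative
    integral {r_plus m a..b + 1} (\<lambda>r. r ^ k *\<^sub>R 1 *\<^sub>R F (e # vs) (ray S R R' x r))) (at 0)"
    by (rule mom_deriv[OF x]) (use assms in \<open>auto simp: ray_def\<close>)
  then show "((\<lambda>h. mom S R R' k vs (x + h *\<^sub>R e)) has_vector_derivative mom S R R' k (e # vs) x) (at 0)"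
    by (simp add: mom_def)
qed

lemma mom_has_dd_radial:
  "has_dd strip e\<^sub>r (mom S R R' k vs)
    (\<lambda>x. S *\<^sub>R (mom S R R' (Suc k) (e\<^sub>t # vs) x - R *\<^sub>R mom S R R' k (e\<^sub>t # vs) x))"
  unfolding has_dd_def
proof
  fix x assume x: "x \<in> strip"
  have "((\<lambda>h. mom S R R' k vs (x + h *\<^sub>R e\<^sub>r)) has_vector_derivative
    integral {r_plus m a..b + 1} (\<lambda>r. r ^ k *\<^sub>R (S * (r - R)) *\<^sub>R F (e\<^sub>t # vs) (ray S R R' x r))) (at 0)"
    by (rule mom_deriv[OF x]) (auto simp: ray_def Xfun_def algebra_simps intro!: continuous_intros)
  moreover have "((\<lambda>r. S *\<^sub>R (r ^ Suc k *\<^sub>R F (e\<^sub>t # vs) (ray S R R' x r) - R *\<^sub>R r ^ k *\<^sub>R F (e\<^sub>t # vs) (ray S R R' x r)))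
    has_integral S *\<^sub>R (mom S R R' (Suc k) (e\<^sub>t # vs) x - R *\<^sub>R mom S R R' k (e\<^sub>t # vs) x)) {r_plus m a..b + 1}"
    by (intro has_integral_cmul has_integral_diff mom_has_integral x)
  then have "((\<lambda>r. r ^ k *\<^sub>R (S * (r - R)) *\<^sub>R F (e\<^sub>t # vs) (ray S R R' x r))
    has_integral S *\<^sub>R (mom S R R' (Suc k) (e\<^sub>t # vs) x - R *\<^sub>R mom S R R' k (e\<^sub>t # vs) x)) {r_plus m a..b + 1}"
    by (simp add: algebra_simps)
  ultimately show "((\<lambda>h. mom S R R' k vs (x + h *\<^sub>R e\<^sub>r)) has_vector_derivative
    S *\<^sub>R (mom S R R' (Suc k) (e\<^sub>t # vs) x - R *\<^sub>R mom S R R' k (e\<^sub>t # vs) x)) (at 0)"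
    by (simp add: integral_unique)
qed

text \<open>The fundamental theorem for r^k times a derivative of \<psi> along the ray: the lower
  boundary term vanishes by \<open>horizon\<close>, the upper one by \<open>F_support\<close>, as b
  + 1 > b. For k = 0 the truncated \<open>k - 1\<close> is harmless because of the factor k.\<close>

lemma mom_by_parts:
  assumes "(v, r', \<theta>, \<phi>) \<in> strip"
  shows "mom S R R' k (e\<^sub>r # vs) (v, r', \<theta>, \<phi>) =
    - Xfun S R' r' *\<^sub>R mom S R R' k (e\<^sub>t # vs) (v, r', \<theta>, \<phi>) - real k *\<^sub>R mom S R R' (k - 1) vs (v, r', \<theta>, \<phi>)"
proof -
  define x where "x = (v, r', \<theta>, \<phi>)"
  define X where "X = Xfun S R' r'"
  let ?I = "{r_plus m a..b + 1}"
  let ?G = "\<lambda>vs r. F vs (ray S R R' x r)"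
  have x: "x \<in> strip"
    using assms by (simp add: x_def)
  have "((\<lambda>r. r ^ k *\<^sub>R ?G vs r) has_vector_derivative
     r ^ k *\<^sub>R (X *\<^sub>R ?G (e\<^sub>t # vs) r + 1 *\<^sub>R ?G (e\<^sub>r # vs) r) + (real k * r ^ (k - 1)) *\<^sub>R ?G vs r) (at r within ?I)"
    if "r \<in> ?I" for r
  proof (rule has_vector_derivative_scaleR)
    show "((\<lambda>r. r ^ k) has_real_derivative real k * r ^ (k - 1)) (at r within ?I)"
      by (auto intro!: derivative_eq_intros)
    have "(ray S R R' x has_vector_derivative X *\<^sub>R e\<^sub>t + 1 *\<^sub>R e\<^sub>r) (at r within ?I)"
    proof -
      have ray: "ray S R R' x = (\<lambda>r. (v - X * R, 0, \<theta>, \<phi>) + r *\<^sub>R (X *\<^sub>R e\<^sub>t + 1 *\<^sub>R e\<^sub>r))"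
        by (auto simp: fun_eq_iff x_def X_def ray_def algebra_simps)
      show ?thesis
        unfolding ray has_vector_derivative_def by (auto intro!: derivative_eq_intros simp: zero_prod_def)
    qed
    then show "(?G vs has_vector_derivative X *\<^sub>R ?G (e\<^sub>t # vs) r + 1 *\<^sub>R ?G (e\<^sub>r # vs) r) (at r within ?I)"
      by (rule F_chain) (use that ray_in_A[OF x] in auto)
  qed
  then have "((\<lambda>r. r ^ k *\<^sub>R (X *\<^sub>R ?G (e\<^sub>t # vs) r + 1 *\<^sub>R ?G (e\<^sub>r # vs) r) + (real k * r ^ (k - 1)) *\<^sub>R ?G vs r)
     has_integral (b + 1) ^ k *\<^sub>R ?G vs (b + 1) - r_plus m a ^ k *\<^sub>R ?G vs (r_plus m a)) ?I"
    by (rule fundamental_theorem_of_calculus[rotated]) (use b in auto)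
  moreover have "?G vs (b + 1) = 0" "?G vs (r_plus m a) = 0"
    using ray_in_A[OF x, of "b + 1" S R R'] ray_in_A[OF x, of "r_plus m a" S R R'] b
    by (auto simp: x_def ray_def intro!: F_support horizon)
  moreover have "((\<lambda>r. X *\<^sub>R r ^ k *\<^sub>R ?G (e\<^sub>t # vs) r + r ^ k *\<^sub>R ?G (e\<^sub>r # vs) r + real k *\<^sub>R r ^ (k - 1) *\<^sub>R ?G vs r)
     has_integral X *\<^sub>R mom S R R' k (e\<^sub>t # vs) x + mom S R R' k (e\<^sub>r # vs) x + real k *\<^sub>R mom S R R' (k - 1) vs x) ?I"
    by (intro has_integral_cmul has_integral_add mom_has_integral x)
  ultimately have "X *\<^sub>R mom S R R' k (e\<^sub>t # vs) x + mom S R R' k (e\<^sub>r # vs) x + real k *\<^sub>R mom S R R' (k - 1) vs x = 0"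
    by (intro has_integral_unique[of _ _ ?I]) (simp_all add: algebra_simps)
  then have "mom S R R' k (e\<^sub>r # vs) x = 0 - X *\<^sub>R mom S R R' k (e\<^sub>t # vs) x - real k *\<^sub>R mom S R R' (k - 1) vs x"
    unfolding eq_diff_eq by (simp only: add_ac)
  then show ?thesis
    unfolding x_def X_def by simp
qed

lemma F_has_jet: "has_jet exterior_interior \<psi> (\<lambda>e. F [e]) (\<lambda>e' e. F [e', e])"
proof -
  have "has_dd exterior_interior e \<psi> (F [e])" for e
    using F_has_dd[of e "[]"] by (simp add: iter_deriv_def)
  then show ?thesis
    unfolding has_jet_def by (intro conjI ballI open_exterior_interior F_has_dd)
qed

text \<open>Differentiating \<open>mom_by_parts\<close> in \<open>v\<close> makes it unnecessary to commute the \<open>u\<close>- and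
  \<open>r\<close>-derivatives of \<open>\<psi>\<close>.\<close>

lemma mom_by_parts_t:
  assumes "(v, r', \<theta>, \<phi>) \<in> strip"
  shows "mom S R R' k (e\<^sub>t # e\<^sub>r # vs) (v, r', \<theta>, \<phi>) =
    - Xfun S R' r' *\<^sub>R mom S R R' k (e\<^sub>t # e\<^sub>t # vs) (v, r', \<theta>, \<phi>) - real k *\<^sub>R mom S R R' (k - 1) (e\<^sub>t # vs) (v, r', \<theta>, \<phi>)"
proof -
  let ?M = "\<lambda>k vs. mom S R R' k vs"
  have "has_dd strip e\<^sub>t (\<lambda>x. (case x of (v, r', \<theta>, \<phi>) \<Rightarrow> - Xfun S R' r' *\<^sub>R ?M k (e\<^sub>t # vs) (v, r', \<theta>, \<phi>))
      - (case x of (v, r', \<theta>, \<phi>) \<Rightarrow> real k *\<^sub>R ?M (k - 1) vs (v, r', \<theta>, \<phi>)))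
    (\<lambda>x. (case x of (v, r', \<theta>, \<phi>) \<Rightarrow> - Xfun S R' r' *\<^sub>R ?M k (e\<^sub>t # e\<^sub>t # vs) (v, r', \<theta>, \<phi>))
      - (case x of (v, r', \<theta>, \<phi>) \<Rightarrow> real k *\<^sub>R ?M (k - 1) (e\<^sub>t # vs) (v, r', \<theta>, \<phi>)))"
    by (intro has_dd_diff has_dd_nonradial_scaleR mom_has_dd) simp_all
  then have 1: "has_dd strip e\<^sub>t (?M k (e\<^sub>r # vs))
    (\<lambda>x. (case x of (v, r', \<theta>, \<phi>) \<Rightarrow> - Xfun S R' r' *\<^sub>R ?M k (e\<^sub>t # e\<^sub>t # vs) (v, r', \<theta>, \<phi>))
      - (case x of (v, r', \<theta>, \<phi>) \<Rightarrow> real k *\<^sub>R ?M (k - 1) (e\<^sub>t # vs) (v, r', \<theta>, \<phi>)))"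
  proof (rule has_dd_cong[OF _ open_strip])
    fix x assume "x \<in> strip"
    then show "(case x of (v, r', \<theta>, \<phi>) \<Rightarrow> - Xfun S R' r' *\<^sub>R ?M k (e\<^sub>t # vs) (v, r', \<theta>, \<phi>))
      - (case x of (v, r', \<theta>, \<phi>) \<Rightarrow> real k *\<^sub>R ?M (k - 1) vs (v, r', \<theta>, \<phi>)) = ?M k (e\<^sub>r # vs) x"
      by (cases x) (simp only: mom_by_parts prod.case)
  qed simp
  have 2: "has_dd strip e\<^sub>t (?M k (e\<^sub>r # vs)) (?M k (e\<^sub>t # e\<^sub>r # vs))"
    by (rule mom_has_dd) simp
  show ?thesis
    using has_dd_unique[OF 2 1 assms] by (simp only: prod.case)
qed

text \<open>The component v\<phi> enters the transformed operator in both orders, while the Kerr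
  side produces only \<open>[e\<^sub>t, e\<^sub>\<phi>]\<close>.\<close>

lemma mom_commute:
  assumes "x \<in> strip"
  shows "mom S R R' k (e\<^sub>\<phi> # e\<^sub>t # vs) x = mom S R R' k (e\<^sub>t # e\<^sub>\<phi> # vs) x"
  unfolding mom_def by (rule integral_cong) (simp add: F_commute ray_in_A[OF assms])

definition mom_dd :: "real \<Rightarrow> real \<Rightarrow> real \<Rightarrow> nat \<Rightarrow> coords list \<Rightarrow> coords \<Rightarrow> cfun" where
  "mom_dd S R R' k vs e = (if e = e\<^sub>r
    then \<lambda>x. S *\<^sub>R (mom S R R' (Suc k) (e\<^sub>t # vs) x - R *\<^sub>R mom S R R' k (e\<^sub>t # vs) x)
    else mom S R R' k (e # vs))"

lemma has_dd_mom_dd: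
  "e \<in> {e\<^sub>t, e\<^sub>r, e\<^sub>\<theta>, e\<^sub>\<phi>} \<Longrightarrow> has_dd strip e (mom S R R' k vs) (mom_dd S R R' k vs e)"
  using mom_has_dd[of e S R R' k vs] mom_has_dd_radial by (auto simp: mom_dd_def)

text \<open>The r'-derivative of a moment is a combination of moments of a u-derivative, so
  \<open>mom_dd\<close> can be applied again. Two such derivatives reach order 2, the degree of the
  Kerr weights.\<close>

lemma mom_has_jet:
  "has_jet strip (mom S R R' 0 []) (mom_dd S R R' 0 [])
    (\<lambda>e' e. if e = e\<^sub>r
      then \<lambda>x. S *\<^sub>R (mom_dd S R R' 1 [e\<^sub>t] e' x - R *\<^sub>R mom_dd S R R' 0 [e\<^sub>t] e' x)
      else mom_dd S R R' 0 [e] e')"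
proof -
  have "has_dd strip e' (mom_dd S R R' 0 [] e) (if e = e\<^sub>r
      then \<lambda>x. S *\<^sub>R (mom_dd S R R' 1 [e\<^sub>t] e' x - R *\<^sub>R mom_dd S R R' 0 [e\<^sub>t] e' x)
      else mom_dd S R R' 0 [e] e')"
    if "e \<in> {e\<^sub>t, e\<^sub>r, e\<^sub>\<theta>, e\<^sub>\<phi>}" "e' \<in> {e\<^sub>t, e\<^sub>r, e\<^sub>\<theta>, e\<^sub>\<phi>}" for e e'
  proof (cases "e = e\<^sub>r")
    case True
    have "has_dd strip e' (\<lambda>x. S *\<^sub>R (mom S R R' 1 [e\<^sub>t] x - R *\<^sub>R mom S R R' 0 [e\<^sub>t] x))
      (\<lambda>x. S *\<^sub>R (mom_dd S R R' 1 [e\<^sub>t] e' x - R *\<^sub>R mom_dd S R R' 0 [e\<^sub>t] e' x))"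
      by (intro has_dd_const_factor has_dd_diff has_dd_mom_dd that) simp_all
    then show ?thesis
      unfolding True mom_dd_def[of _ _ _ _ _ e\<^sub>r] by simp
  next
    case False
    then show ?thesis
      using has_dd_mom_dd[OF that(2), of S R R' 0 "[e]"] by (simp add: mom_dd_def[of _ _ _ _ _ e])
  qed
  then show ?thesis
    unfolding has_jet_def by (intro conjI ballI open_strip has_dd_mom_dd)
qed

section \<open>The transform expressed by moments\<close>

text \<open>The integrand is compared for r > r_+ only: on the horizon, two-sided derivatives
  involve unconstrained values of \<psi> beyond the exterior. Interval and half-line differ by one
  endpoint and a tail on which \<open>H\<close> vanishes.\<close>

lemma whiting_eqI:
  assumes H: "(H has_integral I) {r_plus m a..b + 1}"
    and f: "\<And>r. r_plus m a < r \<Longrightarrow> f (ray S R R' x r) = H r"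
    and H0: "\<And>r. b < r \<Longrightarrow> H r = 0"
  shows "whiting m a S R R' f x = I"
proof -
  have "(H has_integral I) {r_plus m a<..}"
  proof (rule has_integral_spike_set_eq[THEN iffD1, OF _ _ H])
    show "negligible {r \<in> {r_plus m a..b + 1} - {r_plus m a<..}. H r \<noteq> 0}"
      by (rule negligible_subset[of "{r_plus m a}"]) auto
    have "{r \<in> {r_plus m a<..} - {r_plus m a..b + 1}. H r \<noteq> 0} = {}"
      using H0 by force
    then show "negligible {r \<in> {r_plus m a<..} - {r_plus m a..b + 1}. H r \<noteq> 0}"
      by (simp only: negligible_empty)
  qed
  then have "((\<lambda>r. f (ray S R R' x r)) has_integral I) {r_plus m a<..}"
    by (rule has_integral_eq[rotated]) (simp add: f)
  then show ?thesis
    by (cases x) (simp add: ray_def integral_unique)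
qed

lemma whiting_eq_mom:
  assumes "x \<in> strip"
  shows "whiting m a S R R' \<psi> x = mom S R R' 0 [] x"
proof (rule whiting_eqI)
  show "((\<lambda>r. r ^ 0 *\<^sub>R F [] (ray S R R' x r)) has_integral mom S R R' 0 [] x) {r_plus m a..b + 1}"
    by (rule mom_has_integral[OF assms])
  show "r ^ 0 *\<^sub>R F [] (ray S R R' x r) = 0" if "b < r" for r
    using ray_in_A[OF assms, of r S R R'] that b
    by (cases x) (simp add: ray_def F_support)
qed (simp add: iter_deriv_def)

lemma whiting_has_jet:
  "has_jet strip (whiting m a S R R' \<psi>) (mom_dd S R R' 0 [])
    (\<lambda>e' e. if e = e\<^sub>r
      then \<lambda>x. S *\<^sub>R (mom_dd S R R' 1 [e\<^sub>t] e' x - R *\<^sub>R mom_dd S R R' 0 [e\<^sub>t] e' x)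
      else mom_dd S R R' 0 [e] e')"
  by (rule has_jet_cong[OF mom_has_jet]) (simp add: whiting_eq_mom)

text \<open>Taking \<open>P k vs\<close> to be \<open>r ^ k\<close> times a derivative of \<open>\<psi>\<close> gives the Teukolsky operator; taking
  it to be a moment gives the transform of that operator.\<close>

definition teukolsky_form :: "int \<Rightarrow> real \<Rightarrow> (nat \<Rightarrow> coords list \<Rightarrow> complex) \<Rightarrow> complex" where
  "teukolsky_form s \<theta> P =
     (P 2 [e\<^sub>r, e\<^sub>r] - (2 * m) *\<^sub>R P 1 [e\<^sub>r, e\<^sub>r] + a\<^sup>2 *\<^sub>R P 0 [e\<^sub>r, e\<^sub>r])
   + (2 *\<^sub>R P 1 [e\<^sub>r] - (2 * m) *\<^sub>R P 0 [e\<^sub>r])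
   - (P 2 [e\<^sub>t, e\<^sub>r] + a\<^sup>2 *\<^sub>R P 0 [e\<^sub>t, e\<^sub>r])
   - (P 2 [e\<^sub>r, e\<^sub>t] + a\<^sup>2 *\<^sub>R P 0 [e\<^sub>r, e\<^sub>t] + 2 *\<^sub>R P 1 [e\<^sub>t])
   - (2 * a) *\<^sub>R P 0 [e\<^sub>r, e\<^sub>\<phi>]
   + ((1 / sin \<theta>) *\<^sub>R (sin \<theta> *\<^sub>R P 0 [e\<^sub>\<theta>, e\<^sub>\<theta>] + cos \<theta> *\<^sub>R P 0 [e\<^sub>\<theta>])
     + (1 / (sin \<theta>)\<^sup>2) *\<^sub>R P 0 [e\<^sub>\<phi>, e\<^sub>\<phi>]
     + (2 * a) *\<^sub>R P 0 [e\<^sub>t, e\<^sub>\<phi>]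
     + (a\<^sup>2 * (sin \<theta>)\<^sup>2) *\<^sub>R P 0 [e\<^sub>t, e\<^sub>t])
   + 2 * of_int s * (P 1 [e\<^sub>r] - m *\<^sub>R P 0 [e\<^sub>r])
   - 2 * of_int s * (2 *\<^sub>R P 1 [e\<^sub>t] + \<i> * of_real (a * cos \<theta>) * P 0 [e\<^sub>t])
   + 2 * \<i> * of_int s * of_real (cos \<theta> / (sin \<theta>)\<^sup>2) * P 0 [e\<^sub>\<phi>]
   + of_real (of_int s - (of_int s)\<^sup>2 * (cot \<theta>)\<^sup>2) * P 0 []"

lemma teukolsky_eq_form:
  assumes "(u, r, \<theta>, \<phi>) \<in> exterior_interior"
  shows "teukolsky m a s \<psi> (u, r, \<theta>, \<phi>) = teukolsky_form s \<theta> (\<lambda>k vs. r ^ k *\<^sub>R F vs (u, r, \<theta>, \<phi>))"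
  unfolding teukolsky.simps wave_op_eq[OF F_has_jet assms] ang_op_eq[OF F_has_jet assms]
    has_jet_first[OF F_has_jet assms] teukolsky_form_def Delta_def
  by (simp add: scaleR_conv_of_real iter_deriv_def[of _ "[]"] algebra_simps)

text \<open>The form is linear in \<open>P\<close>, and its coefficients depend only on \<theta> and
  the parameters, which are constant along a ray; hence it can be integrated term by term.\<close>

lemma whiting_teukolsky:
  assumes "(v, r', \<theta>, \<phi>) \<in> strip"
  shows "whiting m a S R R' (teukolsky m a s \<psi>) (v, r', \<theta>, \<phi>) =
    teukolsky_form s \<theta> (\<lambda>k vs. mom S R R' k vs (v, r', \<theta>, \<phi>))"
proof -
  define x where "x = (v, r', \<theta>, \<phi>)"
  have x: "x \<in> strip"
    using assms by (simp add: x_def)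
  have "whiting m a S R R' (teukolsky m a s \<psi>) x = teukolsky_form s \<theta> (\<lambda>k vs. mom S R R' k vs x)"
  proof (rule whiting_eqI)
    show "((\<lambda>r. teukolsky_form s \<theta> (\<lambda>k vs. r ^ k *\<^sub>R F vs (ray S R R' x r))) has_integral
       teukolsky_form s \<theta> (\<lambda>k vs. mom S R R' k vs x)) {r_plus m a..b + 1}"
      unfolding teukolsky_form_def
      by (intro has_integral_add has_integral_diff has_integral_cmul has_integral_mult_right mom_has_integral[OF x])
    show "teukolsky m a s \<psi> (ray S R R' x r) = teukolsky_form s \<theta> (\<lambda>k vs. r ^ k *\<^sub>R F vs (ray S R R' x r))"
      if "r_plus m a < r" for r
      unfolding x_def ray_def prod.case
      by (rule teukolsky_eq_form) (use that assms in \<open>auto simp: exterior_interior_def strip_def\<close>)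
    show "teukolsky_form s \<theta> (\<lambda>k vs. r ^ k *\<^sub>R F vs (ray S R R' x r)) = 0" if "b < r" for r
    proof -
      have "F vs (ray S R R' x r) = 0" for vs
        using ray_in_A[OF x, of r S R R'] that b by (simp add: x_def ray_def F_support)
      then show ?thesis
        by (simp add: teukolsky_form_def)
    qed
  qed
  then show ?thesis
    by (simp add: x_def)
qed

lemma teukolsky_tilde_whiting:
  assumes x: "(v, r', \<theta>, \<phi>) \<in> strip" and "S \<noteq> 0"
  shows "teukolsky_tilde m a S R R' s (whiting m a S R R' \<psi>) (v, r', \<theta>, \<phi>)
    = whiting m a S R R' (teukolsky m a s \<psi>) (v, r', \<theta>, \<phi>)"
proof -
  define X where "X = Xfun S R' r'"
  define M where "M k vs = mom S R R' k vs (v, r', \<theta>, \<phi>)" for k vs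
  \<comment> \<open>Used from left to right these rules remove every \<open>e\<^sub>r\<close>;
    \<open>tr\<close> handles the case where the radial derivative is not the outermost one.\<close>
  have r: "M k (e\<^sub>r # vs) = - X *\<^sub>R M k (e\<^sub>t # vs) - real k *\<^sub>R M (k - 1) vs"
    and tr: "M k (e\<^sub>t # e\<^sub>r # vs) = - X *\<^sub>R M k (e\<^sub>t # e\<^sub>t # vs) - real k *\<^sub>R M (k - 1) (e\<^sub>t # vs)"
    and pt: "M k (e\<^sub>\<phi> # e\<^sub>t # vs) = M k (e\<^sub>t # e\<^sub>\<phi> # vs)" for k vs
    unfolding M_def X_def by (rule mom_by_parts[OF x] mom_by_parts_t[OF x] mom_commute[OF x])+
  have D: "mom_dd S R R' k vs e (v, r', \<theta>, \<phi>) =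
    (if e = e\<^sub>r then S *\<^sub>R (M (Suc k) (e\<^sub>t # vs) - R *\<^sub>R M k (e\<^sub>t # vs)) else M k (e # vs))" for k vs e
    by (simp add: mom_dd_def M_def)
  define K where "K = (1 / sin \<theta>) *\<^sub>R (sin \<theta> *\<^sub>R M 0 [e\<^sub>\<theta>, e\<^sub>\<theta>] + cos \<theta> *\<^sub>R M 0 [e\<^sub>\<theta>])
     + (1 / (sin \<theta>)\<^sup>2) *\<^sub>R M 0 [e\<^sub>\<phi>, e\<^sub>\<phi>]
     + (2 * a) *\<^sub>R M 0 [e\<^sub>t, e\<^sub>\<phi>]
     + (a\<^sup>2 * (sin \<theta>)\<^sup>2) *\<^sub>R M 0 [e\<^sub>t, e\<^sub>t]"
  have ang: "ang_op a (whiting m a S R R' \<psi>) (v, r', \<theta>, \<phi>) = K"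
    unfolding ang_op_eq[OF whiting_has_jet x] K_def by (simp add: D)
  \<comment> \<open>With the angular factors and \<open>K\<close> as atoms, powers of S are the only
    denominators left.\<close>
  define c1 c2 c3 where "c1 = a * cos \<theta>" and "c2 = cos \<theta> / (sin \<theta>)\<^sup>2" and "c3 = (cot \<theta>)\<^sup>2"
  show ?thesis
    unfolding whiting_teukolsky[OF x] teukolsky_tilde.simps Let_def wave_op_tilde_eq[OF whiting_has_jet x \<open>S \<noteq> 0\<close>]
      has_jet_first[OF whiting_has_jet x] whiting_eq_mom[OF x] ang
    unfolding M_def[symmetric] X_def[symmetric] teukolsky_form_def K_def[symmetric]
      c1_def[symmetric] c2_def[symmetric] c3_def[symmetric]
    using \<open>S \<noteq> 0\<close>
    \<comment> \<open>Raising the order twice gives \<open>Suc (Suc 0)\<close>, folded here into the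
      literal 2 of \<open>teukolsky_form\<close>.\<close>
    by (simp add: D r tr pt numeral_2_eq_2[symmetric] Delta_def scaleR_conv_of_real field_simps power2_eq_square)
qed

text \<open>Derivatives of the rescaled function require an open neighbourhood that avoids r' = R';
  X \<noteq> 0 places the point in such a set, to which the jet of the transform restricts.\<close>

lemma P_tilde_whiting:
  assumes x: "(v, r', \<theta>, \<phi>) \<in> strip" and "S \<noteq> 0" "Xfun S R' r' \<noteq> 0"
  shows "P_tilde m a S R R' s (rescale R' s (whiting m a S R R' \<psi>)) (v, r', \<theta>, \<phi>)
    = ((r' - R') powi (- s)) *\<^sub>R whiting m a S R R' (teukolsky m a s \<psi>) (v, r', \<theta>, \<phi>)"
proof -
  let ?U = "strip \<inter> {(v, r, \<theta>, \<phi>). r \<noteq> R'}"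
  have "{(v, r, \<theta>, \<phi>). r \<noteq> R'} = UNIV \<times> (- {R'}) \<times> (UNIV :: (real \<times> real) set)"
    by auto
  moreover have "open (UNIV \<times> (- {R'}) \<times> (UNIV :: (real \<times> real) set) :: coords set)"
    by (intro open_Times) auto
  ultimately have "open ({(v, r, \<theta>, \<phi>). r \<noteq> R'} :: coords set)"
    by metis
  then have "open ?U"
    by (intro open_Int open_strip)
  then have "has_jet ?U (whiting m a S R R' \<psi>) (mom_dd S R R' 0 [])
    (\<lambda>e' e. if e = e\<^sub>r
      then \<lambda>x. S *\<^sub>R (mom_dd S R R' 1 [e\<^sub>t] e' x - R *\<^sub>R mom_dd S R R' 0 [e\<^sub>t] e' x)
      else mom_dd S R R' 0 [e] e')"
    by (rule has_jet_subset[OF whiting_has_jet]) simp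
  moreover have "(v, r', \<theta>, \<phi>) \<in> ?U"
    using assms by (auto simp: Xfun_def)
  ultimately show ?thesis
    unfolding teukolsky_tilde_whiting[OF x \<open>S \<noteq> 0\<close>, symmetric]
    by (rule P_tilde_rescale[OF _ _ \<open>S \<noteq> 0\<close> Int_lower2])
qed

end

theorem lemma7p2:
  fixes m a S R R' :: real and s :: int and \<psi> :: cfun
  assumes "m > 0" and "\<bar>a\<bar> < m" and "S < 0"
    and smooth: "smooth_on (kerr_exterior m a) \<psi>"
    and periodic: "\<And>u r \<theta> \<phi>. (u, r, \<theta>, \<phi>) \<in> kerr_exterior m a \<Longrightarrow>
           \<psi> (u, r, \<theta>, \<phi> + 2 * pi) = \<psi> (u, r, \<theta>, \<phi>)"
    and support: "\<exists>b. \<forall>u r \<theta> \<phi>. (u, r, \<theta>, \<phi>) \<in> kerr_exterior m a \<and> r > b \<longrightarrow> \<psi> (u, r, \<theta>, \<phi>) = 0"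
    and horizon: "\<And>vs u \<theta> \<phi>. (u, r_plus m a, \<theta>, \<phi>) \<in> kerr_exterior m a \<Longrightarrow>
           iter_deriv (kerr_exterior m a) vs \<psi> (u, r_plus m a, \<theta>, \<phi>) = 0"
  shows "\<forall>v r' \<theta> \<phi>. 0 < \<theta> \<and> \<theta> < pi \<longrightarrow>
       teukolsky_tilde m a S R R' s (whiting m a S R R' \<psi>) (v, r', \<theta>, \<phi>)
         = whiting m a S R R' (teukolsky m a s \<psi>) (v, r', \<theta>, \<phi>)
     \<and> (Xfun S R' r' \<noteq> 0 \<longrightarrow>
         P_tilde m a S R R' s (rescale R' s (whiting m a S R R' \<psi>)) (v, r', \<theta>, \<phi>)
           = ((r' - R') powi (- s)) *\<^sub>R whiting m a S R R' (teukolsky m a s \<psi>) (v, r', \<theta>, \<phi>))"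
proof -
  obtain b where b: "\<psi> (u, r, \<theta>, \<phi>) = 0" if "(u, r, \<theta>, \<phi>) \<in> kerr_exterior m a" "r > b" for u r \<theta> \<phi>
    using support by blast
  \<comment> \<open>Any larger bound still bounds the support; the maximum also guarantees that it
    is at least r_+.\<close>
  interpret horizon_flat m a "max b (r_plus m a)" \<psi>
    by unfold_locales (use smooth horizon b in auto)
  have "S \<noteq> 0"
    using \<open>S < 0\<close> by simp
  moreover have "(v, r', \<theta>, \<phi>) \<in> strip" if "0 < \<theta> \<and> \<theta> < pi" for v r' \<theta> \<phi>
    using that by (simp add: strip_def)
  ultimately show ?thesis
    by (intro allI impI conjI teukolsky_tilde_whiting P_tilde_whiting) simp_all
qed

end
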